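(* For each $n$, let $n$ independent $p$-values be given, a proportion $\lambda=\lambda_n$ of which correspond to false null hypotheses and have common distribution $G=G^{(n)}$ on $[0,1]$ (which may depend on $n$), the others being uniform on $[0,1]$. Let $\lambda\sim n^{-\gamma}$ with $\gamma\in[\tfrac12,1)$, and suppose that for some $r\in(0,1)$ the distribution $G$ satisfies, for every $q\in(0,1)$, $$\log G^{-1}(q)\sim -r\log n,\qquad\text{i.e. } \lim_{n\to\infty}\frac{\log (G^{(n)})^{-1}(q)}{-r\log n}=1 .$$ Let $\delta\in Q_\nu$ with $\nu\in[0,\tfrac12]$, let $\beta_{n,\alpha_n}$ be a bounding sequence for $\delta$, where $\alpha_n$ vanishes slowly, and let $$\hat\lambda=\sup_{t\in(0,1)}\frac{F_n(t)-t-\beta_{n,\alpha_n}\delta(t)}{1-t}.$$ If $r>\frac1\nu(\gamma-\frac12)$, then $$\frac{\hat\lambda}{\lambda}\xrightarrow{p}1,\qquad n\to\infty.$$ If, on the other hand, $r<\frac1\nu(\gamma-\frac12)$, then $$\frac{\hat\lambda}{\lambda}\xrightarrow{p}0,\qquad n\to\infty.$$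
   Context: Setting: for each $n$ there are $n$ independently tested hypotheses with independent $p$-values $P_1,\dots,P_n$ in $[0,1]$; exactly $\lambda n$ of the null hypotheses are false. $F_n(t)=n^{-1}\sum_{i=1}^n\mathbf 1\{P_i\le t\}$ is the empirical distribution of the $p$-values. $G^{-1}(q)$ denotes the $q$-quantile of $G$. The notation $\lambda\sim n^{-\gamma}$ means that $n^{\gamma}\lambda_n$ converges to a constant in $(0,\infty)$ as $n\to\infty$. $\xrightarrow{p}$ denotes convergence in probability. For $\nu=0$ the conditions $r>\frac1\nu(\gamma-\frac12)$ and $r<\frac1\nu(\gamma-\frac12)$ are read as $\nu r>\gamma-\frac12$ and $\nu r<\gamma-\frac12$, respectively. Bounding function: any real-valued function $\delta$ on $[0,1]$ that is strictly positive on $(0,1)$. Let $U_n(t)$ be the empirical cumulative distribution function of $n$ independent uniform random variables on $[0,1]$, and $$V_{n,\delta}:=\sup_{t\in(0,1)}\frac{U_n(t)-t}{\delta(t)}.$$ Bounding sequence: $\beta_{n,\alpha}$, $n\ge1$, is a bounding sequence for $\delta$ at level $\alpha$ if (a) $n\beta_{n,\alpha}$ is monotonically increasing with $n$; and (b) $P(V_{n,\delta}>\beta_{n,\alpha})<\alpha$ for all $n$. Such a sequence is given for each of the levels $\alpha$ considered, and $\beta_{n,\alpha_n}$ denotes its $n$-th term at level $\alpha=\alpha_n$. Class $Q_\nu$, $\nu\in[0,1]$: the family of real-valued functions $\delta$ on $[0,1]$ such that (a) $\delta(t)$ is nonnegative and finite on $[0,1]$ and strictly positive on $(0,1)$; (b)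 $\delta(1-t)\ge\delta(t)$ for $t\in(0,\tfrac12)$; (c) $\delta$ is regularly varying (at $0$) with power $\nu$, that is, $\lim_{t\to0}\delta(bt)/\delta(t)=b^\nu$ for every $b>0$. Slowly vanishing level: for $\delta\in Q_\nu$ with $\nu\in[0,\tfrac12]$, a sequence of levels $\alpha_n$ decreasing monotonically to $0$ is said to vanish slowly if both $V_{n,\delta}/\beta_{n,\alpha_n}\xrightarrow{p}0$ as $n\to\infty$ and $$\limsup_{n\to\infty}\left(\frac{n}{\log n}\right)^{1/2}\beta_{n,\alpha_n}<\infty.$$
   Formalization: The second claim is stated for ν>0, or ν=0 with liminf of δ(t) at 0 equal to 0. For ν=0 and δ bounded away from 0 near 0 (e.g. δ=1) it is false: the ratio tends to −∞. There, only max(0, λ̂)/λ → 0 in probability is claimed. *)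

theory Defs
  imports "HOL-Probability.Probability"
begin

definition ecdf :: "nat \<Rightarrow> (nat \<Rightarrow> real) \<Rightarrow> real \<Rightarrow> real" where
  "ecdf n p t = real (card {i \<in> {..<n}. p i \<le> t}) / real n"

abbreviation unif01 :: "real measure" where
  "unif01 \<equiv> uniform_measure lborel {0..1}"

definition unif_sample :: "nat \<Rightarrow> (nat \<Rightarrow> real) measure" where
  "unif_sample n = PiM {..<n} (\<lambda>_. unif01)"

definition quantile :: "real measure \<Rightarrow> real \<Rightarrow> real" where
  "quantile G q = Inf {t. q \<le> cdf G t}"

text \<open>The suprema below are taken in the extended reals: for a general bounding function
  the one defining \<open>V_stat\<close> may be infinite.\<close>

definition V_stat :: "nat \<Rightarrow> (real \<Rightarrow> real) \<Rightarrow> (nat \<Rightarrow> real) \<Rightarrow> ereal" where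
  "V_stat n \<delta> u = (SUP t\<in>{0<..<1}. ereal ((ecdf n u t - t) / \<delta> t))"

definition lambda_hat :: "nat \<Rightarrow> (real \<Rightarrow> real) \<Rightarrow> real \<Rightarrow> (nat \<Rightarrow> real) \<Rightarrow> ereal" where
  "lambda_hat n \<delta> b p = (SUP t\<in>{0<..<1}. ereal ((ecdf n p t - t - b * \<delta> t) / (1 - t)))"

text \<open>Convergence in probability to a constant, for variables living on possibly different
  probability spaces.\<close>

definition tendsto_in_prob ::
    "(nat \<Rightarrow> 'a measure) \<Rightarrow> (nat \<Rightarrow> 'a \<Rightarrow> ereal) \<Rightarrow> ereal \<Rightarrow> bool" where
  "tendsto_in_prob M X c \<longleftrightarrow>
     (\<forall>n. X n \<in> borel_measurable (M n)) \<and>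
     (\<forall>\<epsilon>>0. (\<lambda>n. measure (M n) {\<omega> \<in> space (M n). \<bar>X n \<omega> - c\<bar> > ereal \<epsilon>}) \<longlonglongrightarrow> 0)"

definition bounding_seq :: "(real \<Rightarrow> real) \<Rightarrow> real \<Rightarrow> (nat \<Rightarrow> real) \<Rightarrow> bool" where
  "bounding_seq \<delta> a b \<longleftrightarrow>
     mono_on {1..} (\<lambda>n. real n * b n) \<and>
     (\<forall>n\<ge>1. measure (unif_sample n) {u \<in> space (unif_sample n). V_stat n \<delta> u > ereal (b n)} < a)"

definition Q_class :: "real \<Rightarrow> (real \<Rightarrow> real) set" where
  "Q_class \<nu> = {\<delta>.
     (\<forall>t\<in>{0..1}. \<delta> t \<ge> 0) \<and> (\<forall>t\<in>{0<..<1}. \<delta> t > 0) \<and>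
     (\<forall>t\<in>{0<..<1/2}. \<delta> (1 - t) \<ge> \<delta> t) \<and>
     (\<forall>b>0. ((\<lambda>t. \<delta> (b * t) / \<delta> t) \<longlongrightarrow> b powr \<nu>) (at_right 0))}"

text \<open>\<open>\<beta> a n\<close> is the \<open>n\<close>-th term of the bounding sequence at level \<open>a\<close>.\<close>

definition vanishes_slowly ::
    "(real \<Rightarrow> real) \<Rightarrow> (real \<Rightarrow> nat \<Rightarrow> real) \<Rightarrow> (nat \<Rightarrow> real) \<Rightarrow> bool" where
  "vanishes_slowly \<delta> \<beta> \<alpha> \<longleftrightarrow>
     antimono_on {1..} \<alpha> \<and> \<alpha> \<longlonglongrightarrow> 0 \<and>
     tendsto_in_prob unif_sample (\<lambda>n u. V_stat n \<delta> u / ereal (\<beta> (\<alpha> n) n)) 0 \<and>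
     limsup (\<lambda>n. ereal (sqrt (real n / ln (real n)) * \<beta> (\<alpha> n) n)) < \<infinity>"

end

theory Submission
  imports Defs
begin

text \<open>
  Write \<open>F\<^sub>n\<close> as a mixture of the empirical distributions of the null and the false null
  \<open>p\<close>-values.  A slowly vanishing level gives, with probability tending to one, that the
  centred null part stays below \<open>\<eta> * \<beta> * \<delta> t + \<epsilon> * lam * (1 - t)\<close> for all \<open>t\<close>, for any fixed
  \<open>\<eta>, \<epsilon> > 0\<close>: if the nulls cross this line at some \<open>t\<close>, then completing them by independent
  uniforms to a full uniform sample makes the full sample cross \<open>\<eta> * \<beta> * \<delta> t\<close> with probability
  bounded below.

  Taking \<open>\<eta> = 1\<close> bounds the estimator by \<open>(1 + \<epsilon>) * lam\<close>.  For a matching lower bound above the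
  boundary, evaluate at a point \<open>t = n powr (- r + o(1))\<close> beyond the \<open>q\<close>-quantile of \<open>G\<close>, with
  \<open>q\<close> near 1; there \<open>\<beta> * \<delta> t\<close> is of order \<open>n powr (- 1/2 - \<nu> * r + o(1))\<close>, which is negligible
  against \<open>lam\<close>.  Below the boundary take \<open>\<eta> = 1/2\<close>: left of the \<open>q\<close>-quantile, with \<open>q\<close> near 0,
  few false nulls contribute, and right of it \<open>\<beta> * \<delta> t / 2\<close> dominates \<open>2 * lam * (1 - t)\<close>.

  The function \<open>\<delta>\<close> need not be measurable, so regular variation alone does not control it
  between the points of an orbit \<open>t, t/2, t/4, \<dots>\<close>.  Upper bounds are only needed at suitable
  points.  Lower bounds are needed everywhere; they follow because the very existence of a
  bounding sequence keeps \<open>\<delta>\<close> away from 0 on compact subintervals of \<open>(0,1)\<close>.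
\<close>

section \<open>Counts of independent observations\<close>

text \<open>Minus the indicator of a down-set is monotone, and monotone functions on the line are
  Borel.\<close>

lemma borel_down_set:
  fixes B :: "real set"
  assumes "\<And>x y. y \<in> B \<Longrightarrow> x \<le> y \<Longrightarrow> x \<in> B"
  shows "B \<in> sets borel"
proof -
  have "mono (\<lambda>x. - indicat_real B x)"
    using assms by (auto simp: mono_def indicator_def)
  then have "(\<lambda>x. - indicat_real B x) \<in> borel_measurable borel"
    by (rule borel_measurable_mono)
  then have "(\<lambda>x. - indicat_real B x) -` {-1} \<inter> space borel \<in> sets borel"
    by (rule measurable_sets) simp
  also have "(\<lambda>x. - indicat_real B x) -` {-1} \<inter> space borel = B"
    by (auto simp: indicator_def split: if_splits)
  finally show ?thesis .
qed

lemma card_le_mono: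
  fixes x :: "'i \<Rightarrow> real"
  assumes "finite I" "S \<subseteq> I" "\<And>i. i \<in> S \<Longrightarrow> x i \<le> t"
  shows "card S \<le> card {i\<in>I. x i \<le> t}"
  using assms by (intro card_mono) auto

text \<open>The function \<open>a\<close> is arbitrary: the event is a finite union over the subsets of \<open>I\<close> of
  preimages of down-sets, so no regularity in \<open>t\<close> is needed.\<close>

lemma sets_Ex_less_card_le:
  fixes X :: "'i \<Rightarrow> 'a \<Rightarrow> real" and a :: "real \<Rightarrow> real"
  assumes fin: "finite I" and rv: "\<And>i. i \<in> I \<Longrightarrow> X i \<in> borel_measurable M"
  shows "{\<omega> \<in> space M. \<exists>t\<in>T. a t < real (card {i\<in>I. X i \<omega> \<le> t})} \<in> sets M"
proof -
  have eq: "{\<omega> \<in> space M. \<exists>t\<in>T. a t < real (card {i\<in>I. X i \<omega> \<le> t})} =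
    (\<Union>S\<in>Pow I. {\<omega> \<in> space M. \<exists>t\<in>T. a t < real (card S) \<and> (\<forall>i\<in>S. X i \<omega> \<le> t)})"
    (is "?L = ?R")
  proof (intro equalityI subsetI)
    fix \<omega> assume "\<omega> \<in> ?L"
    then obtain t where "\<omega> \<in> space M" "t \<in> T" "a t < real (card {i\<in>I. X i \<omega> \<le> t})" by auto
    then show "\<omega> \<in> ?R" by (intro UN_I[of "{i\<in>I. X i \<omega> \<le> t}"]) auto
  next
    fix \<omega> assume "\<omega> \<in> ?R"
    then obtain S t where S: "S \<subseteq> I" "\<omega> \<in> space M" "t \<in> T" "a t < real (card S)"
        "\<forall>i\<in>S. X i \<omega> \<le> t" by auto
    have "card S \<le> card {i\<in>I. X i \<omega> \<le> t}" using S fin by (intro card_le_mono) auto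
    then show "\<omega> \<in> ?L" using S by force
  qed
  have "{\<omega> \<in> space M. \<exists>t\<in>T. a t < real (card S) \<and> (\<forall>i\<in>S. X i \<omega> \<le> t)} \<in> sets M" if S: "S \<subseteq> I" for S
  proof (cases "S = {}")
    case True
    then show ?thesis by simp
  next
    case False
    \<comment> \<open>For fixed nonempty \<open>S\<close> the observations enter only through their
      maximum over \<open>S\<close>, which must not exceed some \<open>t\<close> in \<open>T\<close>
      with \<open>a t < card S\<close>; the admissible maxima form a down-set.\<close>
    define B where "B = {x. \<exists>t\<in>T. a t < real (card S) \<and> x \<le> t}"
    have finS: "finite S" using S fin by (rule finite_subset)
    have [measurable]: "B \<in> sets borel" by (rule borel_down_set) (auto simp: B_def)
    have [measurable]: "(\<lambda>\<omega>. Max ((\<lambda>i. X i \<omega>) ` S)) \<in> borel_measurable M"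
      using finS rv S by (intro borel_measurable_Max) auto
    have "{\<omega> \<in> space M. \<exists>t\<in>T. a t < real (card S) \<and> (\<forall>i\<in>S. X i \<omega> \<le> t)} =
        {\<omega> \<in> space M. Max ((\<lambda>i. X i \<omega>) ` S) \<in> B}"
      using False finS by (auto simp: B_def)
    also have "\<dots> \<in> sets M" by measurable
    finally show ?thesis .
  qed
  then show ?thesis unfolding eq using fin by (intro sets.finite_UN) auto
qed

text \<open>A supremum, even an uncountable one, exceeds \<open>y\<close> exactly when some member
  does. Since \<open>c t > 0\<close>, this is a crossing of the threshold
  \<open>(z + d t) / c t\<close> by the count, so \<open>sets_Ex_less_card_le\<close>
  applies.\<close>

lemma borel_measurable_SUP_card_le:
  fixes X :: "'i \<Rightarrow> 'a \<Rightarrow> real" and c d :: "real \<Rightarrow> real"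
  assumes "finite I" "\<And>i. i \<in> I \<Longrightarrow> X i \<in> borel_measurable M" "\<And>t. t \<in> T \<Longrightarrow> c t > 0"
  shows "(\<lambda>\<omega>. SUP t\<in>T. ereal (c t * real (card {i\<in>I. X i \<omega> \<le> t}) - d t)) \<in> borel_measurable M"
proof (rule borel_measurableI_greater)
  fix y :: ereal
  show "{\<omega> \<in> space M. y < (SUP t\<in>T. ereal (c t * real (card {i\<in>I. X i \<omega> \<le> t}) - d t))} \<in> sets M"
  proof (cases y)
    case (real z)
    have "{\<omega> \<in> space M. y < (SUP t\<in>T. ereal (c t * real (card {i\<in>I. X i \<omega> \<le> t}) - d t))}
      = {\<omega> \<in> space M. \<exists>t\<in>T. (z + d t) / c t < real (card {i\<in>I. X i \<omega> \<le> t})}"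
      using assms(3) unfolding real less_SUP_iff
      by (auto simp: field_simps)
    then show ?thesis using sets_Ex_less_card_le[OF assms(1,2)] by simp
  next
    case MInf
    then show ?thesis by (auto simp: less_SUP_iff)
  qed auto
qed

lemma borel_measurable_lambda_hat:
  assumes rv: "\<And>i. i < n \<Longrightarrow> X i \<in> borel_measurable M"
  shows "(\<lambda>\<omega>. lambda_hat n \<delta> b (\<lambda>i. X i \<omega>)) \<in> borel_measurable M"
\<comment> \<open>For \<open>n = 0\<close> the empirical distribution is \<open>0 / 0 = 0\<close>,
  so the estimator is constant.\<close>
proof (cases "n = 0")
  case True
  then show ?thesis by (simp add: lambda_hat_def ecdf_def)
next
  case False
  have "(\<lambda>\<omega>. lambda_hat n \<delta> b (\<lambda>i. X i \<omega>)) = (\<lambda>\<omega>. SUP t\<in>{0<..<1::real}. 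
      ereal (1 / (real n * (1 - t)) * real (card {i\<in>{..<n}. X i \<omega> \<le> t}) - (t + b * \<delta> t) / (1 - t)))"
    unfolding lambda_hat_def ecdf_def using False
    by (intro ext SUP_cong refl arg_cong[of _ _ ereal]) (simp add: diff_divide_distrib add_divide_distrib)
  also have "\<dots> \<in> borel_measurable M"
    using rv False by (intro borel_measurable_SUP_card_le) auto
  finally show ?thesis .
qed

lemma of_nat_card_eq_sum_indicator:
  "finite I \<Longrightarrow> real (card {i\<in>I. x i \<in> B}) = (\<Sum>i\<in>I. indicat_real B (x i))"
  by (simp add: indicator_def sum.If_cases Int_def)

section \<open>Markov and Chebyshev bounds for counts\<close>

context prob_space
begin

lemma expectation_indicator_rv:
  assumes [measurable]: "X \<in> borel_measurable M" "B \<in> sets borel"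
  shows "expectation (\<lambda>\<omega>. indicat_real B (X \<omega>)) = prob {\<omega>\<in>space M. X \<omega> \<in> B}"
    and "integrable M (\<lambda>\<omega>. indicat_real B (X \<omega>))"
proof -
  have "expectation (\<lambda>\<omega>. indicat_real B (X \<omega>))
      = expectation (indicat_real {\<omega>\<in>space M. X \<omega> \<in> B})"
    by (intro Bochner_Integration.integral_cong) (auto simp: indicator_def)
  then show "expectation (\<lambda>\<omega>. indicat_real B (X \<omega>)) = prob {\<omega>\<in>space M. X \<omega> \<in> B}" by simp
  show "integrable M (\<lambda>\<omega>. indicat_real B (X \<omega>))"
    by (intro integrable_const_bound[of _ 1]) (auto simp: indicator_def)
qed

text \<open>Markov's inequality for the sum of the hit indicators.\<close>

lemma prob_card_ge_le:
  fixes X :: "'i \<Rightarrow> 'a \<Rightarrow> real"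
  assumes fin: "finite I" and rv: "\<And>i. i \<in> I \<Longrightarrow> X i \<in> borel_measurable M"
    and B: "B \<in> sets borel" and p: "\<And>i. i \<in> I \<Longrightarrow> prob {\<omega>\<in>space M. X i \<omega> \<in> B} \<le> p" and c: "0 < c"
  shows "prob {\<omega>\<in>space M. c \<le> real (card {i\<in>I. X i \<omega> \<in> B})} \<le> real (card I) * p / c"
proof -
  have "prob {\<omega>\<in>space M. c \<le> (\<Sum>i\<in>I. indicat_real B (X i \<omega>))}
      \<le> expectation (\<lambda>\<omega>. \<Sum>i\<in>I. indicat_real B (X i \<omega>)) / c"
    using c by (intro integral_Markov_inequality_measure[where A = "space M"]
        Bochner_Integration.integrable_sum expectation_indicator_rv(2) rv B)
      (auto intro!: AE_I2 sum_nonneg)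
  also have "expectation (\<lambda>\<omega>. \<Sum>i\<in>I. indicat_real B (X i \<omega>))
      = (\<Sum>i\<in>I. expectation (\<lambda>\<omega>. indicat_real B (X i \<omega>)))"
    by (intro Bochner_Integration.integral_sum expectation_indicator_rv(2) rv B)
  also have "\<dots> = (\<Sum>i\<in>I. prob {\<omega>\<in>space M. X i \<omega> \<in> B})"
    by (intro sum.cong refl expectation_indicator_rv(1) rv B)
  also have "\<dots> \<le> real (card I) * p"
    using sum_mono[OF p] by simp
  finally show ?thesis
    using c by (simp add: of_nat_card_eq_sum_indicator[OF fin] divide_right_mono)
qed

text \<open>Chebyshev's inequality for the lower tail: independence kills the covariances, and each
  variance \<open>p - p^2\<close> is at most \<open>p\<close>.\<close>

lemma prob_card_le_le:
  fixes X :: "'i \<Rightarrow> 'a \<Rightarrow> real"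
  assumes fin: "finite I" and ind: "indep_vars (\<lambda>_. borel) X I"
    and B: "B \<in> sets borel" and p: "\<And>i. i \<in> I \<Longrightarrow> prob {\<omega>\<in>space M. X i \<omega> \<in> B} = p" and c: "0 < c"
  shows "prob {\<omega>\<in>space M. real (card {i\<in>I. X i \<omega> \<in> B}) \<le> real (card I) * p - c} \<le> real (card I) * p / c\<^sup>2"
proof -
  have rv: "X i \<in> borel_measurable M" if "i \<in> I" for i using ind that by (auto simp: indep_vars_def)
  define Y where "Y i \<omega> = indicat_real B (X i \<omega>) - p" for i \<omega>
  have [measurable]: "Y i \<in> borel_measurable M" if "i \<in> I" for i
    unfolding Y_def using rv[OF that] B by measurable
  have intY: "integrable M (Y i)" "expectation (Y i) = 0" if "i \<in> I" for i
    unfolding Y_def using expectation_indicator_rv[OF rv[OF that] B] p[OF that]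
    by (auto simp: prob_space)
  have bd: "\<bar>Y i \<omega>\<bar> \<le> 1 + \<bar>p\<bar>" for i \<omega> by (auto simp: Y_def indicator_def)
  have intYY: "integrable M (\<lambda>\<omega>. Y i \<omega> * Y j \<omega>)" if "i \<in> I" "j \<in> I" for i j
    using that by (intro integrable_const_bound[of _ "(1 + \<bar>p\<bar>) * (1 + \<bar>p\<bar>)"] AE_I2)
      (auto simp: abs_mult intro!: mult_mono bd)
  have cov: "expectation (\<lambda>\<omega>. Y i \<omega> * Y j \<omega>) = 0" if ij: "i \<in> I" "j \<in> I" "i \<noteq> j" for i j
  proof -
    have "indep_vars (\<lambda>_. borel) X {i, j}" using ind ij by (intro indep_vars_subset[OF ind]) auto
    from indep_vars_compose2[OF this, where Y = "\<lambda>_ x. indicat_real B x - p" and N = "\<lambda>_. borel"]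
    have "indep_vars (\<lambda>_. borel) Y {i, j}"
      using B unfolding Y_def[abs_def] by simp
    from indep_vars_lebesgue_integral[OF _ this] show ?thesis using ij intY by auto
  qed
  have var: "expectation (\<lambda>\<omega>. Y i \<omega> * Y i \<omega>) \<le> p" if i: "i \<in> I" for i
  proof -
    \<comment> \<open>An indicator equals its square, so the square of \<open>Y i \<omega>\<close>
      is affine in it.\<close>
    have "expectation (\<lambda>\<omega>. Y i \<omega> * Y i \<omega>) = expectation (\<lambda>\<omega>. (1 - 2 * p) * indicat_real B (X i \<omega>) + p\<^sup>2)"
      by (intro Bochner_Integration.integral_cong) (auto simp: Y_def indicator_def power2_eq_square algebra_simps)
    also have "\<dots> = (1 - 2 * p) * p + p\<^sup>2"
      using expectation_indicator_rv[OF rv[OF i] B] p[OF i] by (simp add: prob_space)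
    also have "\<dots> \<le> p" by (simp add: algebra_simps power2_eq_square)
    finally show ?thesis .
  qed
  define S where "S \<omega> = (\<Sum>i\<in>I. Y i \<omega>)" for \<omega>
  have S2: "(S \<omega>)\<^sup>2 = (\<Sum>i\<in>I. \<Sum>j\<in>I. Y i \<omega> * Y j \<omega>)" for \<omega>
    unfolding S_def power2_eq_square by (rule sum_product)
  have "prob {\<omega>\<in>space M. real (card {i\<in>I. X i \<omega> \<in> B}) \<le> real (card I) * p - c}
      \<le> prob {\<omega>\<in>space M. c\<^sup>2 \<le> (S \<omega>)\<^sup>2}"
  proof (intro finite_measure_mono subsetI)
    fix \<omega> assume "\<omega> \<in> {\<omega>\<in>space M. real (card {i\<in>I. X i \<omega> \<in> B}) \<le> real (card I) * p - c}"
    then have "\<omega> \<in> space M" "S \<omega> \<le> - c"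
      by (auto simp: S_def Y_def sum_subtractf of_nat_card_eq_sum_indicator[OF fin])
    then show "\<omega> \<in> {\<omega>\<in>space M. c\<^sup>2 \<le> (S \<omega>)\<^sup>2}" using c
      by (auto simp: abs_le_square_iff[symmetric])
  qed (auto simp: S_def)
  also have "\<dots> \<le> expectation (\<lambda>\<omega>. (S \<omega>)\<^sup>2) / c\<^sup>2"
  proof (rule integral_Markov_inequality_measure[where A = "space M"])
    show "integrable M (\<lambda>\<omega>. (S \<omega>)\<^sup>2)"
      unfolding S2 using intYY by (intro Bochner_Integration.integrable_sum)
  qed (use c in auto)
  also have "expectation (\<lambda>\<omega>. (S \<omega>)\<^sup>2) = (\<Sum>i\<in>I. \<Sum>j\<in>I. expectation (\<lambda>\<omega>. Y i \<omega> * Y j \<omega>))"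
    unfolding S2 using intYY by (simp add: Bochner_Integration.integral_sum)
  also have "\<dots> = (\<Sum>i\<in>I. expectation (\<lambda>\<omega>. Y i \<omega> * Y i \<omega>))"
  proof (rule sum.cong[OF refl])
    fix i assume i: "i \<in> I"
    have "(\<Sum>j\<in>I. expectation (\<lambda>\<omega>. Y i \<omega> * Y j \<omega>)) = (\<Sum>j\<in>{i}. expectation (\<lambda>\<omega>. Y i \<omega> * Y j \<omega>))"
      using i fin cov by (intro sum.mono_neutral_right) auto
    then show "(\<Sum>j\<in>I. expectation (\<lambda>\<omega>. Y i \<omega> * Y j \<omega>)) = expectation (\<lambda>\<omega>. Y i \<omega> * Y i \<omega>)" by simp
  qed
  also have "\<dots> \<le> real (card I) * p"
    using sum_mono[OF var] by simp
  finally show ?thesis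
    using c by (simp add: divide_right_mono)
qed

end

section \<open>Crossings in a subsample\<close>

lemma prob_space_unif01: "prob_space unif01"
  by (rule prob_space_uniform_measure) auto

lemma measure_unif01:
  assumes "B \<in> sets borel"
  shows "measure unif01 B = measure lborel ({0..1} \<inter> B)"
  using assms by (subst measure_uniform_measure) auto

lemma measure_unif01_atMost: "0 \<le> t \<Longrightarrow> t \<le> 1 \<Longrightarrow> measure unif01 {..t} = t"
  and measure_unif01_greaterThan: "0 \<le> t \<Longrightarrow> t \<le> 1 \<Longrightarrow> measure unif01 {t<..} = 1 - t"
proof -
  assume t: "0 \<le> t" "t \<le> 1"
  have "{0..1} \<inter> {..t} = {0..t}" "{0..1} \<inter> {t<..} = {t<..1}" using t by auto
  then show "measure unif01 {..t} = t" "measure unif01 {t<..} = 1 - t"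
    using t by (simp_all add: measure_unif01)
qed

lemma prob_space_PiM_unif01: "prob_space (PiM I (\<lambda>_. unif01))"
  by (intro prob_space_PiM prob_space_unif01)

lemma borel_measurable_PiM_unif01:
  "i \<in> I \<Longrightarrow> (\<lambda>x. x i) \<in> borel_measurable (PiM I (\<lambda>_. unif01))"
  using measurable_component_singleton[of i I "\<lambda>_. unif01"]
  by (simp cong: measurable_cong_sets)

lemma measure_PiM_unif01_component:
  assumes "i \<in> I" "B \<in> sets borel"
  shows "measure (PiM I (\<lambda>_. unif01)) {x \<in> space (PiM I (\<lambda>_. unif01)). x i \<in> B} = measure unif01 B"
proof -
  have "measure unif01 B = measure (distr (PiM I (\<lambda>_. unif01)) unif01 (\<lambda>x. x i)) B"
    using distr_PiM_component[of I "\<lambda>_. unif01" i] prob_space_unif01 assms by simp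
  also have "\<dots> = measure (PiM I (\<lambda>_. unif01)) ((\<lambda>x. x i) -` B \<inter> space (PiM I (\<lambda>_. unif01)))"
    using assms by (intro measure_distr) auto
  finally show ?thesis by (simp add: vimage_def Int_def conj_commute)
qed

section \<open>Joining two independent blocks of uniforms\<close>

lemma card_le_add_card_gt:
  fixes x :: "'i \<Rightarrow> real"
  assumes "finite I"
  shows "real (card {i\<in>I. x i \<le> t}) + real (card {i\<in>I. x i \<in> {t<..}}) = real (card I)"
proof -
  have "card {i\<in>I. x i \<le> t} + card {i\<in>I. x i \<in> {t<..}} = card ({i\<in>I. x i \<le> t} \<union> {i\<in>I. x i \<in> {t<..}})"
    using assms by (intro card_Un_disjoint[symmetric]) auto
  also have "{i\<in>I. x i \<le> t} \<union> {i\<in>I. x i \<in> {t<..}} = I" by auto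
  finally show ?thesis by linarith
qed

lemma card_Un_disjoint_le:
  fixes x :: "'i \<Rightarrow> real"
  assumes "finite I" "finite J" "I \<inter> J = {}"
  shows "card {i\<in>I \<union> J. x i \<le> t} = card {i\<in>I. x i \<le> t} + card {i\<in>J. x i \<le> t}"
proof -
  have "{i\<in>I \<union> J. x i \<le> t} = {i\<in>I. x i \<le> t} \<union> {i\<in>J. x i \<le> t}" by auto
  then show ?thesis using assms by (simp add: card_Un_disjoint disjoint_iff)
qed

text \<open>Given a crossing of the \<open>I\<close>-part at \<open>t\<close>, the independent \<open>J\<close>-part
  undershoots its mean by at most \<open>\<epsilon> * card J * (1 - t)\<close> at that \<open>t\<close> with probability at least
  \<open>\<epsilon> / (1 + \<epsilon>)\<close>, by Markov's inequality for the number of points in \<open>{t<..}\<close>.\<close>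

lemma prob_crossing_subsample:
  fixes I J :: "'i set" and a :: "real \<Rightarrow> real"
  defines "U \<equiv> \<lambda>K :: 'i set. PiM K (\<lambda>_. unif01)"
  assumes fin: "finite I" "finite J" and disj: "I \<inter> J = {}" and e: "\<epsilon> > 0"
  shows "\<epsilon> / (1 + \<epsilon>) * measure (U I) {x\<in>space (U I). \<exists>t\<in>{0<..<1}.
             a t + real (card I) * t + \<epsilon> * real (card J) * (1 - t) < real (card {i\<in>I. x i \<le> t})}
       \<le> measure (U (I \<union> J)) {x\<in>space (U (I \<union> J)). \<exists>t\<in>{0<..<1}.
             a t + real (card (I \<union> J)) * t < real (card {i\<in>I \<union> J. x i \<le> t})}"
    (is "?q * measure _ ?E \<le> measure _ ?W")
proof -
  interpret product_prob_space "\<lambda>_::'i. unif01"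
    by (simp add: product_prob_space_def product_prob_space_axioms_def product_sigma_finite_def
        prob_space_unif01 prob_space_imp_sigma_finite)
  interpret UI: prob_space "U I" unfolding U_def by (rule prob_space_PiM_unif01)
  interpret UJ: prob_space "U J" unfolding U_def by (rule prob_space_PiM_unif01)
  interpret UIJ: prob_space "U (I \<union> J)" unfolding U_def by (rule prob_space_PiM_unif01)
  have E: "?E \<in> sets (U I)"
    using fin unfolding U_def by (intro sets_Ex_less_card_le) auto
  have W: "?W \<in> sets (U (I \<union> J))"
    using fin unfolding U_def by (intro sets_Ex_less_card_le) auto
  have merge_space: "merge I J (x, y) \<in> space (U (I \<union> J))" if "x \<in> space (U I)" "y \<in> space (U J)" for x y
    using that by (auto simp: U_def space_PiM PiE_iff merge_def extensional_def)
  \<comment> \<open>A bound on the section over each crossing \<open>x\<close>, uniform in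
    \<open>x\<close>; integrating it over \<open>?E\<close> by Fubini produces the factor
    \<open>?q\<close>.\<close>
  have sec: "ennreal ?q \<le> emeasure (U J) ((\<lambda>y. merge I J (x, y)) -` ?W \<inter> space (U J))"
    if x: "x \<in> ?E" for x
  proof -
    obtain t where t: "t \<in> {0<..<1}" and xs: "x \<in> space (U I)" and
      cr: "a t + real (card I) * t + \<epsilon> * real (card J) * (1 - t) < real (card {i\<in>I. x i \<le> t})"
      using x by auto
    \<comment> \<open>The threshold \<open>t\<close> depends on \<open>x\<close> but stays fixed
      while \<open>y\<close> varies, so no measurable choice of \<open>t\<close> is
      involved.\<close>
    define V where "V = {y\<in>space (U J). real (card J) * (t - \<epsilon> * (1 - t)) \<le> real (card {i\<in>J. y i \<le> t})}"
    have sub: "V \<subseteq> (\<lambda>y. merge I J (x, y)) -` ?W \<inter> space (U J)"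
    proof
      fix y assume y: "y \<in> V"
      let ?z = "merge I J (x, y)"
      have "{i\<in>I. ?z i \<le> t} = {i\<in>I. x i \<le> t}" "{i\<in>J. ?z i \<le> t} = {i\<in>J. y i \<le> t}"
        using disj by (auto simp: merge_def)
      then have "a t + real (card (I \<union> J)) * t < real (card {i\<in>I \<union> J. ?z i \<le> t})"
        unfolding card_Un_disjoint_le[OF fin disj] card_Un_disjoint[OF fin disj]
        using cr y by (simp add: V_def algebra_simps)
      then show "y \<in> (\<lambda>y. merge I J (x, y)) -` ?W \<inter> space (U J)"
        using t y xs merge_space by (auto simp: V_def)
    qed
    have V: "V \<in> sets (U J)"
    proof -
      have "V = {y\<in>space (U J). \<exists>s\<in>{t}. real (card J) * (t - \<epsilon> * (1 - t)) \<le> (\<Sum>i\<in>J. indicat_real {..s} (y i))}"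
        using of_nat_card_eq_sum_indicator[OF fin(2), of _ "{..t}"] by (simp add: V_def)
      also have "\<dots> \<in> sets (U J)" unfolding U_def by measurable
      finally show ?thesis .
    qed
    have "?q \<le> UJ.prob V"
    proof (cases "card J = 0")
      case True
      then have "V = space (U J)" by (simp add: V_def)
      then show ?thesis using e by (simp add: UJ.prob_space)
    next
      case False
      \<comment> \<open>Outside \<open>V\<close> fewer than
        \<open>card J * (t - \<epsilon> * (1 - t))\<close> points lie at or below \<open>t\<close>,
        so more than \<open>c\<close> points lie above it, which is \<open>1 + \<epsilon>\<close>
        times their mean number.\<close>
      define c where "c = (1 + \<epsilon>) * real (card J) * (1 - t)"
      have c: "c > 0" using False e t by (simp add: c_def)
      have "1 - UJ.prob V = UJ.prob (space (U J) - V)" using V by (simp add: UJ.prob_compl)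
      also have "\<dots> \<le> UJ.prob {y\<in>space (U J). c \<le> real (card {i\<in>J. y i \<in> {t<..}})}"
      proof (intro UJ.finite_measure_mono subsetI)
        fix y assume "y \<in> space (U J) - V"
        then show "y \<in> {y\<in>space (U J). c \<le> real (card {i\<in>J. y i \<in> {t<..}})}"
          using card_le_add_card_gt[OF fin(2), of y t] by (auto simp: V_def c_def algebra_simps)
        next
        have "{y\<in>space (U J). c \<le> real (card {i\<in>J. y i \<in> {t<..}})} =
           {y\<in>space (U J). c \<le> (\<Sum>i\<in>J. indicat_real {t<..} (y i))}"
          using fin by (simp only: of_nat_card_eq_sum_indicator)
        also have "\<dots> \<in> UJ.events" unfolding U_def by measurable
        finally show "{y\<in>space (U J). c \<le> real (card {i\<in>J. y i \<in> {t<..}})} \<in> UJ.events" .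
      qed
      also have "\<dots> \<le> real (card J) * (1 - t) / c"
      proof (rule UJ.prob_card_ge_le)
        show "UJ.prob {y\<in>space (U J). y i \<in> {t<..}} \<le> 1 - t" if "i \<in> J" for i
          unfolding U_def using t that
          by (subst measure_PiM_unif01_component, simp, simp, subst measure_unif01_greaterThan) auto
        show "(\<lambda>y. y i) \<in> borel_measurable (U J)" if "i \<in> J" for i
          using that unfolding U_def by measurable
      qed (use fin c in auto)
      also have "\<dots> = 1 / (1 + \<epsilon>)"
        using nonzero_divide_mult_cancel_right[of "real (card J) * (1 - t)" "1 + \<epsilon>"] False t
        by (simp add: c_def mult.assoc)
      finally have "1 - 1 / (1 + \<epsilon>) \<le> UJ.prob V" by simp
      also have "1 - 1 / (1 + \<epsilon>) = ?q" using e by (simp add: field_simps)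
      finally show ?thesis .
    qed
    then have "ennreal ?q \<le> emeasure (U J) V"
      by (simp add: UJ.emeasure_eq_measure ennreal_leI)
    also have "\<dots> \<le> emeasure (U J) ((\<lambda>y. merge I J (x, y)) -` ?W \<inter> space (U J))"
    proof (intro emeasure_mono sub)
      have "(\<lambda>y. merge I J (x, y)) \<in> measurable (U J) (U (I \<union> J))"
        unfolding U_def using xs by (simp add: U_def)
      then show "(\<lambda>y. merge I J (x, y)) -` ?W \<inter> space (U J) \<in> UJ.events"
        using W by (rule measurable_sets)
    qed
    finally show ?thesis .
  qed
  have "ennreal (?q * UI.prob ?E) = ennreal ?q * emeasure (U I) ?E"
    unfolding UI.emeasure_eq_measure using e by (intro ennreal_mult) auto
  also have "\<dots> = (\<integral>\<^sup>+x. ennreal ?q * indicator ?E x \<partial>U I)"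
    using E by (simp add: nn_integral_cmult_indicator)
  also have "\<dots> \<le> (\<integral>\<^sup>+x. emeasure (U J) ((\<lambda>y. merge I J (x, y)) -` ?W \<inter> space (U J)) \<partial>U I)"
    using sec by (intro nn_integral_mono) (auto simp: indicator_def)
  also have "\<dots> = emeasure (U (I \<union> J)) ?W"
    using emeasure_fold_integral[OF disj fin, of ?W] W by (simp add: U_def)
  also have "\<dots> = ennreal (UIJ.prob ?W)" by (simp add: UIJ.emeasure_eq_measure)
  finally show ?thesis by (simp add: ennreal_le_iff)
qed

section \<open>Deviation of the uniform empirical distribution at one half\<close>

lemma (in prob_space) integrable_affine:
  fixes f :: "'a \<Rightarrow> real"
  assumes "integrable M f"
  shows "integrable M (\<lambda>x. a + b * f x)" "expectation (\<lambda>x. a + b * f x) = a + b * expectation f"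
  using assms by (simp_all add: prob_space)

text \<open>Integrates a pointwise bound: above the level \<open>z\<close>, AM-GM gives
  \<open>Z \<le> (c / 2) * Z^2 + 1 / (2 * c)\<close>, and elsewhere
  \<open>Z \<le> z\<close>.\<close>

lemma (in prob_space) paley_zygmund:
  fixes Z :: "'a \<Rightarrow> real"
  assumes Z: "integrable M Z" "integrable M (\<lambda>\<omega>. (Z \<omega>)\<^sup>2)"
    and d: "0 \<le> z" "0 < d" "z + d \<le> expectation Z" and K: "0 < K" "expectation (\<lambda>\<omega>. (Z \<omega>)\<^sup>2) \<le> K"
  shows "d\<^sup>2 / K \<le> prob {\<omega>\<in>space M. z < Z \<omega>}"
proof -
  \<comment> \<open>The optimal weight: the second moment term then takes up half of
    \<open>d\<close>, leaving \<open>d / 2\<close> to be paid by the event.\<close>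
  define c where "c = d / K"
  have c: "c > 0" using d K by (simp add: c_def)
  define A where "A = {\<omega>\<in>space M. z < Z \<omega>}"
  have le: "Z \<omega> \<le> z + (c / 2) * (Z \<omega>)\<^sup>2 + (1 / (2 * c)) * indicat_real A \<omega>" if "\<omega> \<in> space M" for \<omega>
  proof (cases "z < Z \<omega>")
    case True
    have "0 \<le> (c * Z \<omega> - 1)\<^sup>2 / (2 * c)" using c by simp
    also have "\<dots> = (c / 2) * (Z \<omega>)\<^sup>2 - Z \<omega> + 1 / (2 * c)"
      using c by (simp add: power2_eq_square field_simps)
    finally show ?thesis using True that d by (simp add: A_def)
  next
    case False
    then show ?thesis using c by (simp add: A_def add_increasing2)
  qed
  have "Z \<in> borel_measurable M" using Z by simp
  then have A: "A \<in> events" unfolding A_def by measurable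
  have lin: "integrable M (\<lambda>\<omega>. z + a * (Z \<omega>)\<^sup>2 + b * indicat_real A \<omega>)"
    "expectation (\<lambda>\<omega>. z + a * (Z \<omega>)\<^sup>2 + b * indicat_real A \<omega>)
      = z + a * expectation (\<lambda>\<omega>. (Z \<omega>)\<^sup>2) + b * prob A" for a b :: real
  proof -
    have iA: "integrable M (indicat_real A)"
      using A by (intro integrable_const_bound[of _ 1]) auto
    then show "integrable M (\<lambda>\<omega>. z + a * (Z \<omega>)\<^sup>2 + b * indicat_real A \<omega>)"
      using Z(2) by (intro Bochner_Integration.integrable_add integrable_mult_right) auto
    show "expectation (\<lambda>\<omega>. z + a * (Z \<omega>)\<^sup>2 + b * indicat_real A \<omega>)
      = z + a * expectation (\<lambda>\<omega>. (Z \<omega>)\<^sup>2) + b * prob A"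
      using Z(2) iA A by (subst Bochner_Integration.integral_add) (simp_all add: prob_space)
  qed
  have "z + d \<le> z + (c / 2) * expectation (\<lambda>\<omega>. (Z \<omega>)\<^sup>2) + (1 / (2 * c)) * prob A"
    using d(3) integral_mono[OF Z(1) lin(1) le] unfolding lin(2) by (rule order_trans)
  moreover have "(c / 2) * expectation (\<lambda>\<omega>. (Z \<omega>)\<^sup>2) \<le> (c / 2) * K"
    using K c by (intro mult_left_mono) auto
  ultimately have "d \<le> (c / 2) * K + prob A / (2 * c)" by simp
  also have "(c / 2) * K = d / 2" using K by (simp add: c_def)
  finally have "d * c \<le> prob A" using c by (simp add: field_simps)
  then show ?thesis by (simp add: c_def power2_eq_square A_def)
qed

text \<open>\<open>2 * cosh x - 2\<close> is the square of
  \<open>exp (x / 2) - exp (- x / 2)\<close>, which is at least \<open>x / 2\<close>.\<close>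

lemma cosh_ge_real: "1 + x\<^sup>2 / 8 \<le> cosh (x::real)" if "0 \<le> x"
proof -
  define y where "y = x / 2"
  have "1 + y \<le> exp y" by (rule exp_ge_add_one_self)
  moreover have "exp (- y) \<le> 1" using that by (simp add: y_def)
  ultimately have "y \<le> exp y - exp (- y)" by linarith
  then have "y\<^sup>2 \<le> (exp y - exp (- y))\<^sup>2"
    using that by (intro power_mono) (auto simp: y_def)
  also have "\<dots> = exp x + exp (- x) - 2"
    by (simp add: power2_eq_square algebra_simps y_def flip: exp_add)
  finally show ?thesis by (simp add: cosh_field_def y_def power2_eq_square field_simps)
qed

lemma cosh_le_real: "cosh (x::real) \<le> 1 + x\<^sup>2" if "0 \<le> x" "x \<le> 1"
proof -
  have "exp x \<le> 1 + x + x\<^sup>2" using that by (rule exp_bound)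
  moreover have "exp (- x) \<le> 1 - x + x\<^sup>2"
  proof -
    \<comment> \<open>Compares through \<open>1 / (1 + x)\<close>: the product
      \<open>(1 - x + x^2) * (1 + x)\<close> is \<open>1 + x^3\<close>.\<close>
    have "exp (- x) * (1 + x) \<le> exp (- x) * exp x"
      by (intro mult_left_mono exp_ge_add_one_self) auto
    also have "\<dots> = 1" by (simp flip: exp_add)
    also have "1 \<le> (1 - x + x\<^sup>2) * (1 + x)" using that by (simp add: algebra_simps power2_eq_square)
    finally show ?thesis using that by simp
  qed
  ultimately show ?thesis by (simp add: cosh_field_def)
qed

section \<open>Exponential moments of the count at one half\<close>

text \<open>The centred indicator takes the values 1/2 and -1/2 with equal probability, so its
  moment generating function is a cosh.\<close>

lemma integral_exp_indicator_unif01: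
  fixes \<theta> :: real
  shows "integrable unif01 (\<lambda>x. exp (\<theta> * (indicat_real {..1/2} x - 1/2)))"
    and "(\<integral>x. exp (\<theta> * (indicat_real {..1/2} x - 1/2)) \<partial>unif01) = cosh (\<theta> / 2)"
proof -
  interpret prob_space unif01 by (rule prob_space_unif01)
  have eq: "(\<lambda>x. exp (\<theta> * (indicat_real {..1/2} x - 1/2)))
     = (\<lambda>x. exp (- \<theta> / 2) + (exp (\<theta> / 2) - exp (- \<theta> / 2)) * indicat_real {..1/2} x)"
    by (auto simp: indicator_def)
  have i: "integrable unif01 (indicat_real {..1/2})"
  proof (rule integrable_const_bound)
    show "AE x in unif01. norm (indicat_real {..1/2} x) \<le> 1" by (rule AE_I2) (simp add: indicator_def)
    show "indicat_real {..1/2} \<in> borel_measurable unif01" by measurable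
  qed
  show "integrable unif01 (\<lambda>x. exp (\<theta> * (indicat_real {..1/2} x - 1/2)))"
    unfolding eq by (rule integrable_affine[OF i])
  have "(\<integral>x. exp (\<theta> * (indicat_real {..1/2} x - 1/2)) \<partial>unif01) =
      exp (- \<theta> / 2) + (exp (\<theta> / 2) - exp (- \<theta> / 2)) * expectation (indicat_real {..1/2})"
    unfolding eq by (rule integrable_affine[OF i])
  also have "expectation (indicat_real {..1/2}) = 1/2"
    using measure_unif01_atMost[of "1/2"] by (simp add: space_uniform_measure)
  also have "exp (- \<theta> / 2) + (exp (\<theta> / 2) - exp (- \<theta> / 2)) * (1/2) = cosh (\<theta> / 2)"
    by (simp add: cosh_field_def field_simps)
  finally show "(\<integral>x. exp (\<theta> * (indicat_real {..1/2} x - 1/2)) \<partial>unif01) = cosh (\<theta> / 2)" .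
qed

lemma integral_exp_card_unif_sample:
  fixes \<theta> :: real and n :: nat
  defines "Z \<equiv> \<lambda>u. exp (\<theta> * (real (card {i\<in>{..<n}. u i \<le> 1/2}) - real n / 2))"
  shows "integrable (unif_sample n) Z" and "(\<integral>u. Z u \<partial>unif_sample n) = cosh (\<theta> / 2) ^ n"
proof -
  interpret product_prob_space "\<lambda>_::nat. unif01"
    by (simp add: product_prob_space_def product_prob_space_axioms_def product_sigma_finite_def
        prob_space_unif01 prob_space_imp_sigma_finite)
  have "real (card {i\<in>{..<n}. u i \<le> 1/2}) - real n / 2 = (\<Sum>i\<in>{..<n}. indicat_real {..1/2} (u i) - 1/2)"
    for u :: "nat \<Rightarrow> real"
    using of_nat_card_eq_sum_indicator[of "{..<n}" u "{..1/2}"] unfolding atMost_iff sum_subtractf by simp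
  then have eq: "Z = (\<lambda>u. \<Prod>i\<in>{..<n}. exp (\<theta> * (indicat_real {..1/2} (u i) - 1/2)))"
    unfolding Z_def by (simp only: exp_sum sum_distrib_left finite_lessThan)
  show "integrable (unif_sample n) Z"
    unfolding eq unif_sample_def
    using integral_exp_indicator_unif01(1) by (intro product_integrable_prod) auto
  show "(\<integral>u. Z u \<partial>unif_sample n) = cosh (\<theta> / 2) ^ n"
    unfolding eq unif_sample_def
    by (subst product_integral_prod[where f = "\<lambda>i x. exp (\<theta> * (indicat_real {..1/2} x - 1/2))"])
      (use integral_exp_indicator_unif01 in auto)
qed

text \<open>An elementary substitute for the central limit theorem: the exponential moment at
  \<open>\<theta> = 1 / sqrt n\<close> stays above 1 by a fixed amount while the one at
  \<open>2 * \<theta>\<close> stays bounded, so Paley-Zygmund gives a deviation of order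
  \<open>sqrt n\<close> with probability bounded below.\<close>

lemma unif_sample_deviation_half:
  obtains c p :: real where "c > 0" "p > 0"
    "\<And>n. n \<ge> 1 \<Longrightarrow> p \<le> measure (unif_sample n)
       {u\<in>space (unif_sample n). c * sqrt (real n) < real (card {i\<in>{..<n}. u i \<le> 1/2}) - real n / 2}"
proof
  \<comment> \<open>The mean of \<open>Z\<close> exceeds 1 by at least 1/32. One half of this lifts
    the level to 65/64, whose logarithm is positive; the other half is the gap for Paley-Zygmund,
    and 3 bounds the second moment through \<open>exp 1\<close>.\<close>
  show "ln (65/64) > (0::real)" "(1/64)\<^sup>2 / 3 > (0::real)" by auto
  fix n :: nat assume n: "n \<ge> 1"
  interpret prob_space "unif_sample n" unfolding unif_sample_def by (rule prob_space_PiM_unif01)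
  define \<theta> where "\<theta> = 1 / sqrt (real n)"
  have th: "0 < \<theta>" "\<theta> \<le> 1" "\<theta>\<^sup>2 = 1 / real n" using n by (auto simp: \<theta>_def power_divide)
  define S where "S u = real (card {i\<in>{..<n}. u i \<le> 1/2}) - real n / 2" for u :: "nat \<Rightarrow> real"
  define Z where "Z u = exp (\<theta> * S u)" for u
  have Z2: "(Z u)\<^sup>2 = exp ((2 * \<theta>) * S u)" for u
    by (simp add: Z_def power2_eq_square flip: exp_add)
  have "1 + 1/64 + 1/64 \<le> 1 + real n * (\<theta>\<^sup>2 / 32)" using n th by simp
  also have "\<dots> \<le> (1 + \<theta>\<^sup>2 / 32) ^ n"
    by (rule Bernoulli_inequality) (simp add: order_trans[of _ 0])
  also have "\<dots> \<le> cosh (\<theta> / 2) ^ n"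
  proof (rule power_mono)
    show "1 + \<theta>\<^sup>2 / 32 \<le> cosh (\<theta> / 2)"
      using cosh_ge_real[of "\<theta> / 2"] th(1) by (simp add: power_divide)
    show "0 \<le> 1 + \<theta>\<^sup>2 / 32" by (simp add: add_nonneg_nonneg)
  qed
  also have "\<dots> = expectation Z"
    using integral_exp_card_unif_sample(2)[of n \<theta>] by (simp add: Z_def[abs_def] S_def[abs_def])
  finally have E1: "65/64 + 1/64 \<le> expectation Z" by simp
  have "expectation (\<lambda>u. (Z u)\<^sup>2) = cosh \<theta> ^ n"
    using integral_exp_card_unif_sample(2)[of n "2 * \<theta>"] by (simp add: Z2 S_def[abs_def])
  also have "\<dots> \<le> (1 + \<theta>\<^sup>2) ^ n"
    by (rule power_mono[OF cosh_le_real]) (use th(1,2) in \<open>auto intro: less_imp_le[OF cosh_real_pos]\<close>)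
  also have "\<dots> \<le> exp (\<theta>\<^sup>2) ^ n"
    by (intro power_mono exp_ge_add_one_self) auto
  also have "\<dots> = exp 1" using n th by (simp flip: exp_of_nat_mult)
  also have "\<dots> \<le> 3" by (rule exp_le)
  finally have E2: "expectation (\<lambda>u. (Z u)\<^sup>2) \<le> 3" .
  have "(1/64)\<^sup>2 / 3 \<le> prob {u\<in>space (unif_sample n). 65/64 < Z u}"
  proof (rule paley_zygmund)
    show "integrable (unif_sample n) Z" "integrable (unif_sample n) (\<lambda>u. (Z u)\<^sup>2)"
      unfolding Z2 using integral_exp_card_unif_sample(1)[of n] by (auto simp: Z_def[abs_def] S_def[abs_def])
  qed (use E1 E2 in auto)
  also have "{u\<in>space (unif_sample n). 65/64 < Z u} = {u\<in>space (unif_sample n). ln (65/64) * sqrt (real n) < S u}"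
  proof (intro Collect_cong conj_cong refl)
    fix u
    have "65/64 < Z u \<longleftrightarrow> exp (ln (65/64)) < exp (\<theta> * S u)" by (simp add: Z_def)
    also have "\<dots> \<longleftrightarrow> ln (65/64) * sqrt (real n) < S u"
      using n by (simp only: exp_less_cancel_iff) (simp add: \<theta>_def field_simps)
    finally show "65/64 < Z u \<longleftrightarrow> ln (65/64) * sqrt (real n) < S u" .
  qed
  finally show "(1/64)\<^sup>2 / 3 \<le> prob {u\<in>space (unif_sample n). ln (65/64) * sqrt (real n) < real (card {i\<in>{..<n}. u i \<le> 1/2}) - real n / 2}"
    by (simp add: S_def)
qed

section \<open>Regular variation along dyadic orbits\<close>

lemma Q_classD:
  assumes "\<delta> \<in> Q_class \<nu>"
  shows "0 < t \<Longrightarrow> t < 1 \<Longrightarrow> \<delta> t > 0"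
    and "0 < t \<Longrightarrow> t < 1/2 \<Longrightarrow> \<delta> t \<le> \<delta> (1 - t)"
    and "b > 0 \<Longrightarrow> ((\<lambda>t. \<delta> (b * t) / \<delta> t) \<longlongrightarrow> b powr \<nu>) (at_right 0)"
  using assms by (auto simp: Q_class_def)

text \<open>Without measurability of \<open>\<delta>\<close> the uniform convergence theorem for regularly varying
  functions is not available, so all estimates go along orbits of \<open>t \<mapsto> t / 2\<close>.\<close>

lemma Q_class_halving:
  assumes \<delta>: "\<delta> \<in> Q_class \<nu>" and k: "\<kappa> > 0"
  obtains t0 where "0 < t0" "t0 < 1/2"
    "\<And>t. 0 < t \<Longrightarrow> t \<le> t0 \<Longrightarrow> \<delta> (t / 2) \<ge> (1/2) powr (\<nu> + \<kappa>) * \<delta> t"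
    "\<And>t. 0 < t \<Longrightarrow> t \<le> t0 \<Longrightarrow> \<delta> (t / 2) \<le> (1/2) powr (\<nu> - \<kappa>) * \<delta> t"
proof -
  have lim: "((\<lambda>t. \<delta> (1/2 * t) / \<delta> t) \<longlongrightarrow> (1/2) powr \<nu>) (at_right 0)"
    using Q_classD(3)[OF \<delta>, of "1/2"] by simp
  have "(1/2::real) powr (\<nu> + \<kappa>) < (1/2) powr \<nu>" "(1/2::real) powr \<nu> < (1/2) powr (\<nu> - \<kappa>)"
    using k by (auto intro!: powr_less_mono')
  then have "\<forall>\<^sub>F t in at_right 0. (1/2) powr (\<nu> + \<kappa>) < \<delta> (1/2 * t) / \<delta> t
      \<and> \<delta> (1/2 * t) / \<delta> t < (1/2) powr (\<nu> - \<kappa>)"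
    using lim by (intro eventually_conj) (auto dest: order_tendstoD)
  then obtain b where b: "b > 0" and
    ev: "\<And>t. 0 < t \<Longrightarrow> t < b \<Longrightarrow> (1/2) powr (\<nu> + \<kappa>) < \<delta> (1/2 * t) / \<delta> t
      \<and> \<delta> (1/2 * t) / \<delta> t < (1/2) powr (\<nu> - \<kappa>)"
    by (auto simp: eventually_at_right_field)
  define t0 where "t0 = min (b / 2) (1/4)"
  show ?thesis
  proof
    show "0 < t0" "t0 < 1/2" using b by (auto simp: t0_def)
    fix t assume t: "0 < t" "t \<le> t0"
    then have "0 < \<delta> t" using Q_classD(1)[OF \<delta>, of t] by (auto simp: t0_def)
    then show "\<delta> (t / 2) \<ge> (1/2) powr (\<nu> + \<kappa>) * \<delta> t" "\<delta> (t / 2) \<le> (1/2) powr (\<nu> - \<kappa>) * \<delta> t"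
      using ev[of t] t b by (auto simp: t0_def pos_less_divide_eq pos_divide_less_eq min_def split: if_splits)
  qed
qed

text \<open>\<open>t\<close> is doubled for as long as it stays at or below \<open>t0\<close>;
  \<open>k\<close> counts the doublings.\<close>

lemma dyadic_decomposition:
  fixes t t0 :: real
  assumes "0 < t" "t \<le> t0"
  obtains k :: nat and x where "t0 / 2 < x" "x \<le> t0" "t = (1/2) ^ k * x"
proof -
  define P where "P k \<longleftrightarrow> t0 < 2 ^ k * t" for k :: nat
  obtain n :: nat where "t0 / t < 2 ^ n" using real_arch_pow[of 2 "t0 / t"] by auto
  then have "P n" using assms by (simp add: P_def field_simps)
  moreover have "\<not> P 0" using assms by (simp add: P_def)
  ultimately obtain k where k: "\<not> P k" "P (Suc k)"
    using ex_least_nat_less[of P n] by auto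
  show ?thesis
  proof
    show "t0 / 2 < 2 ^ k * t" "2 ^ k * t \<le> t0" using k by (auto simp: P_def)
    show "t = (1/2) ^ k * (2 ^ k * t)" by (simp add: power_divide)
  qed
qed

lemma half_power_Suc_powr:
  "((1/2) ^ Suc k) powr a = (1/2) powr a * ((1/2) ^ k) powr (a::real)"
  unfolding power_Suc by (rule powr_mult)

text \<open>The bound is carried along the single orbit of \<open>t0\<close>, started from the one
  value \<open>\<delta> t0\<close>, because no uniform upper bound for \<open>\<delta>\<close> on
  \<open>{t0 / 2..t0}\<close> is available. Every small \<open>t\<close> still has an orbit point
  within a factor 2 above it.\<close>

lemma Q_class_dyadic_upper:
  assumes \<delta>: "\<delta> \<in> Q_class \<nu>" and k: "\<kappa> > 0"
  obtains C t0 where "C > 0" "0 < t0" "t0 < 1/2"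
    "\<And>t. 0 < t \<Longrightarrow> t < t0 \<Longrightarrow> \<exists>s\<ge>t. s \<le> 2 * t \<and> s \<le> t0 \<and> \<delta> s \<le> C * s powr (\<nu> - \<kappa>)"
proof -
  obtain t0 where t0: "0 < t0" "t0 < 1/2"
    "\<And>t. 0 < t \<Longrightarrow> t \<le> t0 \<Longrightarrow> \<delta> (t / 2) \<le> (1/2) powr (\<nu> - \<kappa>) * \<delta> t"
    using Q_class_halving[OF \<delta> k] by metis
  have d0: "\<delta> t0 > 0" using Q_classD(1)[OF \<delta>] t0 by auto
  have orbit: "\<delta> ((1/2) ^ k * t0) \<le> ((1/2) ^ k) powr (\<nu> - \<kappa>) * \<delta> t0" for k :: nat
  proof (induction k)
    case (Suc k)
    have "(1/2::real) ^ k * t0 \<le> 1 * t0" using t0 by (intro mult_right_mono power_le_one) auto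
    then have "\<delta> ((1/2) ^ Suc k * t0) \<le> (1/2) powr (\<nu> - \<kappa>) * \<delta> ((1/2) ^ k * t0)"
      using t0(3)[of "(1/2) ^ k * t0"] t0 by simp
    also have "\<dots> \<le> (1/2) powr (\<nu> - \<kappa>) * (((1/2) ^ k) powr (\<nu> - \<kappa>) * \<delta> t0)"
      by (intro mult_left_mono Suc) auto
    also have "\<dots> = ((1/2) ^ Suc k) powr (\<nu> - \<kappa>) * \<delta> t0"
      unfolding half_power_Suc_powr by (simp only: mult.assoc)
    finally show ?case .
  qed simp
  show ?thesis
  proof (rule that[of "t0 powr - (\<nu> - \<kappa>) * \<delta> t0" t0])
    fix t assume t: "0 < t" "t < t0"
    obtain k x where x: "t0 / 2 < x" "x \<le> t0" "t = (1/2) ^ k * x"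
      by (rule dyadic_decomposition[of t t0]) (use t in auto)
    \<comment> \<open>The point of the orbit of \<open>t0\<close> at the depth of \<open>t\<close>;
      since \<open>x\<close> lies within a factor 2 of \<open>t0\<close>, so does \<open>t\<close>
      of \<open>s\<close>.\<close>
    define s where "s = (1/2) ^ k * t0"
    have "t \<le> s" "s \<le> 2 * t" "s \<le> t0"
      using x t0 by (auto simp: s_def mult_left_le_one_le power_le_one intro!: mult_left_mono)
    moreover have "\<delta> s \<le> t0 powr - (\<nu> - \<kappa>) * \<delta> t0 * s powr (\<nu> - \<kappa>)"
    proof -
      have "t0 powr - (\<nu> - \<kappa>) * \<delta> t0 * s powr (\<nu> - \<kappa>)
          = (t0 powr - (\<nu> - \<kappa>) * t0 powr (\<nu> - \<kappa>)) * (((1/2) ^ k) powr (\<nu> - \<kappa>) * \<delta> t0)"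
        unfolding s_def by (simp only: powr_mult mult_ac)
      also have "t0 powr - (\<nu> - \<kappa>) * t0 powr (\<nu> - \<kappa>) = 1"
        using t0 by (simp flip: powr_add)
      finally show ?thesis using orbit[of k] unfolding s_def[symmetric] by linarith
    qed
    ultimately show "\<exists>s\<ge>t. s \<le> 2 * t \<and> s \<le> t0 \<and> \<delta> s \<le> t0 powr - (\<nu> - \<kappa>) * \<delta> t0 * s powr (\<nu> - \<kappa>)"
      by blast
  qed (use t0 d0 in auto)
qed

text \<open>The hypothesis is the local positivity of \<open>\<delta>\<close> that the existence of a bounding sequence
  provides.\<close>

lemma Q_class_lower:
  assumes \<delta>: "\<delta> \<in> Q_class \<nu>" and \<nu>: "0 \<le> \<nu>" "\<nu> \<le> 1/2" and k: "0 < \<kappa>" "\<kappa> \<le> 1/2"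
    and loc: "\<And>a b. 0 < a \<Longrightarrow> b < 1 \<Longrightarrow> \<exists>m>0. \<forall>t\<in>{a..b}. m \<le> \<delta> t"
  obtains m where "m > 0" "\<And>t. 0 < t \<Longrightarrow> t < 1 \<Longrightarrow> m * t powr (\<nu> + \<kappa>) * (1 - t) \<le> \<delta> t"
proof -
  obtain t0 where t0: "0 < t0" "t0 < 1/2"
    "\<And>t. 0 < t \<Longrightarrow> t \<le> t0 \<Longrightarrow> \<delta> (t / 2) \<ge> (1/2) powr (\<nu> + \<kappa>) * \<delta> t"
    using Q_class_halving[OF \<delta> k(1)] by metis
  \<comment> \<open>The interval contains both the starting points \<open>(t0 / 2, t0]\<close> of
    all orbits and the middle range up to \<open>1 - t0\<close>, so one \<open>m\<close> serves
    both.\<close>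
  obtain m where m: "m > 0" "\<And>t. t0 / 2 \<le> t \<Longrightarrow> t \<le> 1 - t0 \<Longrightarrow> m \<le> \<delta> t"
    using loc[of "t0 / 2" "1 - t0"] t0 by auto
  have orbit: "((1/2) ^ k) powr (\<nu> + \<kappa>) * \<delta> x \<le> \<delta> ((1/2) ^ k * x)"
    if x: "0 < x" "x \<le> t0" for k :: nat and x
  proof (induction k)
    case (Suc k)
    have "(1/2::real) ^ k * x \<le> 1 * t0" using x by (intro mult_mono power_le_one) auto
    then have "(1/2) powr (\<nu> + \<kappa>) * \<delta> ((1/2) ^ k * x) \<le> \<delta> ((1/2) ^ Suc k * x)"
      using t0(3)[of "(1/2) ^ k * x"] x by simp
    moreover have "(1/2) powr (\<nu> + \<kappa>) * (((1/2) ^ k) powr (\<nu> + \<kappa>) * \<delta> x)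
        \<le> (1/2) powr (\<nu> + \<kappa>) * \<delta> ((1/2) ^ k * x)"
      by (intro mult_left_mono Suc) auto
    moreover have "((1/2) ^ Suc k) powr (\<nu> + \<kappa>) * \<delta> x = (1/2) powr (\<nu> + \<kappa>) * (((1/2) ^ k) powr (\<nu> + \<kappa>) * \<delta> x)"
      unfolding half_power_Suc_powr by (simp only: mult.assoc)
    ultimately show ?case by linarith
  qed simp
  have small: "m * t powr (\<nu> + \<kappa>) \<le> \<delta> t" if t: "0 < t" "t \<le> t0" for t
  proof -
    obtain k x where x: "t0 / 2 < x" "x \<le> t0" "t = (1/2) ^ k * x"
      by (rule dyadic_decomposition[of t t0]) (use t in auto)
    have "t \<le> (1/2) ^ k" using x t0 by simp
    then have "t powr (\<nu> + \<kappa>) \<le> ((1/2) ^ k) powr (\<nu> + \<kappa>)"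
      using t \<nu> k by (intro powr_mono2) auto
    then have "m * t powr (\<nu> + \<kappa>) \<le> \<delta> x * ((1/2) ^ k) powr (\<nu> + \<kappa>)"
      using m(1) m(2)[of x] x t0 by (intro mult_mono) auto
    also have "\<dots> \<le> \<delta> t" using orbit[of x k] x t0 by (simp add: mult.commute)
    finally show ?thesis .
  qed
  show ?thesis
  proof
    show "m > 0" by fact
    fix t :: real assume t: "0 < t" "t < 1"
    have le1: "s powr (\<nu> + \<kappa>) \<le> 1" if "0 < s" "s < 1" for s
      using that \<nu> k by (intro powr_le1) auto
    consider "t \<le> t0" | "t0 \<le> t" "t \<le> 1 - t0" | "1 - t0 < t" by linarith
    then show "m * t powr (\<nu> + \<kappa>) * (1 - t) \<le> \<delta> t"
    proof cases
      case 1
      have "m * t powr (\<nu> + \<kappa>) * (1 - t) \<le> m * t powr (\<nu> + \<kappa>)"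
        using t m by (intro mult_left_le) auto
      also have "\<dots> \<le> \<delta> t" using small t 1 by simp
      finally show ?thesis .
    next
      case 2
      have "t powr (\<nu> + \<kappa>) * (1 - t) \<le> 1"
        using le1[of t] t by (intro mult_le_one) auto
      then have "m * t powr (\<nu> + \<kappa>) * (1 - t) \<le> m"
        using m(1) mult_left_le[of "t powr (\<nu> + \<kappa>) * (1 - t)" m] by (simp add: mult.assoc)
      also have "\<dots> \<le> \<delta> t" using m 2 t0 by simp
      finally show ?thesis .
    next
      case 3
      \<comment> \<open>Near 1 the reflected point \<open>s\<close> takes over. The factor
        \<open>1 - t\<close> equals \<open>s\<close>, and
        \<open>s \<le> s powr (\<nu> + \<kappa>)\<close> because the exponent is at most 1.\<close>
      define s where "s = 1 - t"
      have s: "0 < s" "s < t0" using 3 t by (auto simp: s_def)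
      have "m * t powr (\<nu> + \<kappa>) * (1 - t) \<le> m * 1 * s"
        using le1[of t] t m s by (intro mult_mono) (auto simp: s_def)
      also have "\<dots> \<le> m * s powr (\<nu> + \<kappa>)"
        using m s t0 \<nu> k powr_mono'[of "\<nu> + \<kappa>" 1 s] by (auto simp: mult_left_mono)
      also have "\<dots> \<le> \<delta> s" using small s by simp
      also have "\<dots> \<le> \<delta> t" using Q_classD(2)[OF \<delta>, of s] s t0 by (simp add: s_def)
      finally show ?thesis .
    qed
  qed
qed

text \<open>Orbit points with \<open>\<delta> s \<le> C * s powr (\<nu> / 2)\<close> accumulate at
  0. This is what later makes the estimator nonnegative when \<open>\<nu> > 0\<close>.\<close>

lemma Q_class_Liminf_zero:
  assumes \<delta>: "\<delta> \<in> Q_class \<nu>" and \<nu>: "\<nu> > 0"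
  shows "Liminf (at_right 0) (\<lambda>t. ereal (\<delta> t)) = 0"
proof (rule antisym)
  obtain C t0 where C: "C > 0" "0 < t0" "t0 < 1/2"
    "\<And>t. 0 < t \<Longrightarrow> t < t0 \<Longrightarrow> \<exists>s\<ge>t. s \<le> 2 * t \<and> s \<le> t0 \<and> \<delta> s \<le> C * s powr (\<nu> - \<nu> / 2)"
    using Q_class_dyadic_upper[OF \<delta>, of "\<nu> / 2"] \<nu> by auto
  show "0 \<le> Liminf (at_right 0) (\<lambda>t. ereal (\<delta> t))"
    using Q_classD(1)[OF \<delta>]
    by (intro Liminf_bounded eventually_at_rightI[of 0 1]) (auto intro: less_imp_le)
  show "Liminf (at_right 0) (\<lambda>t. ereal (\<delta> t)) \<le> 0"
  proof (rule ccontr)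
    assume "\<not> ?thesis"
    then obtain e where "0 < ereal e" and eL: "ereal e < Liminf (at_right 0) (\<lambda>t. ereal (\<delta> t))"
      using ereal_dense2[of 0 "Liminf (at_right 0) (\<lambda>t. ereal (\<delta> t))"] by (auto simp: not_le)
    then have e: "e > 0" by simp
    have "\<forall>\<^sub>F t in at_right (0::real). 0 \<le> t" by (rule eventually_at_rightI[of 0 1]) auto
    then have "((\<lambda>t. C * t powr (\<nu> / 2)) \<longlongrightarrow> C * 0 powr (\<nu> / 2)) (at_right 0)"
      using \<nu> by (intro tendsto_intros tendsto_powr') auto
    then have "\<forall>\<^sub>F t in at_right 0. C * t powr (\<nu> / 2) < e"
      using e by (auto dest: order_tendstoD)
    then obtain b where b: "b > 0" "\<And>t. 0 < t \<Longrightarrow> t < b \<Longrightarrow> C * t powr (\<nu> / 2) < e"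
      by (auto simp: eventually_at_right_field)
    have "\<forall>\<^sub>F t in at_right 0. ereal e < ereal (\<delta> t)" using eL by (rule less_LiminfD)
    then obtain b' where b': "b' > 0" "\<And>t. 0 < t \<Longrightarrow> t < b' \<Longrightarrow> e < \<delta> t"
      by (auto simp: eventually_at_right_field)
    \<comment> \<open>The orbit point \<open>s\<close> may be as large as \<open>2 * t\<close>, so
      \<open>2 * t\<close> must stay below both bounds.\<close>
    define t where "t = min (min b b') t0 / 4"
    have t: "0 < t" "t < t0" "2 * t < b" "2 * t < b'"
      using b b' C by (auto simp: t_def)
    obtain s where s: "t \<le> s" "s \<le> 2 * t" "\<delta> s \<le> C * s powr (\<nu> / 2)"
      using C(4)[OF t(1,2)] by auto
    show False using b(2)[of s] b'(2)[of s] s t by linarith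
  qed
qed

section \<open>Consequences of the bounding sequence, and quantiles\<close>

lemma borel_measurable_V_stat:
  assumes \<delta>: "\<delta> \<in> Q_class \<nu>" and n: "n \<ge> 1"
  shows "V_stat n \<delta> \<in> borel_measurable (unif_sample n)"
proof -
  have "V_stat n \<delta> = (\<lambda>u. SUP t\<in>{0<..<1::real}.
      ereal (1 / (real n * \<delta> t) * real (card {i\<in>{..<n}. u i \<le> t}) - t / \<delta> t))"
    unfolding V_stat_def ecdf_def
    by (intro ext SUP_cong refl arg_cong[of _ _ ereal]) (simp add: diff_divide_distrib)
  also have "\<dots> \<in> borel_measurable (unif_sample n)"
    unfolding unif_sample_def using Q_classD(1)[OF \<delta>] n borel_measurable_PiM_unif01
    by (intro borel_measurable_SUP_card_le) auto
  finally show ?thesis .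
qed

lemma V_stat_ge:
  "0 < t \<Longrightarrow> t < 1 \<Longrightarrow> ereal ((ecdf n u t - t) / \<delta> t) \<le> V_stat n \<delta> u"
  unfolding V_stat_def by (intro SUP_upper) auto

text \<open>With a single observation below \<open>a\<close> the statistic is at least \<open>(1 - c) / inf \<delta>\<close> over \<open>{a..c}\<close>,
  so a vanishing infimum would make \<open>V_stat 1 \<delta>\<close> infinite with probability at least \<open>a\<close>.\<close>

lemma bounding_seq_local_lower_bound:
  assumes \<delta>: "\<delta> \<in> Q_class \<nu>" and bs: "bounding_seq \<delta> \<alpha> b" and a: "0 < a" "\<alpha> \<le> a" "c < 1"
  shows "\<exists>m>0. \<forall>t\<in>{a..c}. m \<le> \<delta> t"
proof (rule ccontr)
  assume neg: "\<not> ?thesis"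
  interpret prob_space "unif_sample 1" unfolding unif_sample_def by (rule prob_space_PiM_unif01)
  \<comment> \<open>Chosen so that \<open>(1 - c) / m = \<bar>b 1\<bar> + 1\<close>, which exceeds
    \<open>b 1\<close>.\<close>
  define m where "m = (1 - c) / (\<bar>b 1\<bar> + 1)"
  have m: "m > 0" using a by (auto simp: m_def)
  obtain t where t: "a \<le> t" "t \<le> c" "\<delta> t < m" using neg m by (meson atLeastAtMost_iff not_le)
  have dt: "\<delta> t > 0" using Q_classD(1)[OF \<delta>, of t] t a by auto
  have "a = measure unif01 {..a}" using measure_unif01_atMost[of a] a t by auto
  also have "\<dots> = prob {u \<in> space (unif_sample 1). u 0 \<in> {..a}}"
    unfolding unif_sample_def by (rule measure_PiM_unif01_component[symmetric]) auto
  also have "\<dots> \<le> prob {u \<in> space (unif_sample 1). V_stat 1 \<delta> u > ereal (b 1)}"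
  proof (rule finite_measure_mono)
    show "{u \<in> space (unif_sample 1). u 0 \<in> {..a}} \<subseteq> {u \<in> space (unif_sample 1). V_stat 1 \<delta> u > ereal (b 1)}"
    proof
      fix u assume "u \<in> {u \<in> space (unif_sample 1). u 0 \<in> {..a}}"
      then have us: "u \<in> space (unif_sample 1)" and "u 0 \<in> {..a}" by auto
      then have "{i. i < Suc 0 \<and> u i \<le> t} = {0}" using t by auto
      then have "ecdf 1 u t = 1" by (simp add: ecdf_def)
      have "b 1 < (\<bar>b 1\<bar> + 1)" by linarith
      also have "\<dots> = (1 - c) / m" using a by (simp add: m_def)
      also have "\<dots> \<le> (1 - t) / \<delta> t" using t dt a by (intro frac_le) auto
      also have "\<dots> = (ecdf 1 u t - t) / \<delta> t" by (simp only: \<open>ecdf 1 u t = 1\<close>)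
      finally have "ereal (b 1) < ereal ((ecdf 1 u t - t) / \<delta> t)" by simp
      also have "\<dots> \<le> V_stat 1 \<delta> u" using t a by (intro V_stat_ge) auto
      finally show "u \<in> {u \<in> space (unif_sample 1). V_stat 1 \<delta> u > ereal (b 1)}"
        using us by simp
    qed
    show "{u \<in> space (unif_sample 1). V_stat 1 \<delta> u > ereal (b 1)} \<in> events"
      using borel_measurable_V_stat[OF \<delta>, of 1] by measurable
  qed
  also have "\<dots> < \<alpha>" using bs by (simp add: bounding_seq_def)
  finally show False using a by simp
qed

text \<open>If \<open>b n\<close> were smaller, the deviation at \<open>t = 1/2\<close> alone would
  make the statistic exceed it with probability at least \<open>p\<close>, contradicting a level of
  at most \<open>p\<close>.\<close>

lemma bounding_seq_ge:
  assumes \<delta>: "\<delta> \<in> Q_class \<nu>"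
  obtains c p :: real where "c > 0" "p > 0"
    "\<And>n \<alpha> b. n \<ge> 1 \<Longrightarrow> bounding_seq \<delta> \<alpha> b \<Longrightarrow> \<alpha> \<le> p \<Longrightarrow> c / sqrt (real n) \<le> b n"
proof -
  have d: "\<delta> (1/2) > 0" using Q_classD(1)[OF \<delta>] by auto
  obtain c p :: real where cp: "c > 0" "p > 0" "\<And>n. n \<ge> 1 \<Longrightarrow> p \<le> measure (unif_sample n)
       {u\<in>space (unif_sample n). c * sqrt (real n) < real (card {i\<in>{..<n}. u i \<le> 1/2}) - real n / 2}"
    by (rule unif_sample_deviation_half) blast
  show ?thesis
  proof (rule that[of "c / \<delta> (1/2)" p])
    fix n :: nat and \<alpha> :: real and b
    assume n: "n \<ge> 1" and bs: "bounding_seq \<delta> \<alpha> b" and le: "\<alpha> \<le> p"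
    interpret prob_space "unif_sample n" unfolding unif_sample_def by (rule prob_space_PiM_unif01)
    show "c / \<delta> (1/2) / sqrt (real n) \<le> b n"
    proof (rule ccontr)
      assume "\<not> ?thesis"
      then have bn: "b n < c / \<delta> (1/2) / sqrt (real n)" by simp
      have "p \<le> prob {u\<in>space (unif_sample n). c * sqrt (real n) < real (card {i\<in>{..<n}. u i \<le> 1/2}) - real n / 2}"
        using cp n by auto
      also have "\<dots> \<le> prob {u \<in> space (unif_sample n). V_stat n \<delta> u > ereal (b n)}"
      proof (rule finite_measure_mono)
        show "{u\<in>space (unif_sample n). c * sqrt (real n) < real (card {i\<in>{..<n}. u i \<le> 1/2}) - real n / 2}
          \<subseteq> {u \<in> space (unif_sample n). V_stat n \<delta> u > ereal (b n)}"
        proof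
          fix u
          assume "u \<in> {u\<in>space (unif_sample n). c * sqrt (real n) < real (card {i\<in>{..<n}. u i \<le> 1/2}) - real n / 2}"
          then have us: "u \<in> space (unif_sample n)"
            and "c * sqrt (real n) < real (card {i\<in>{..<n}. u i \<le> 1/2}) - real n / 2" by auto
          from this(2) have "c * sqrt (real n) / real n < (real (card {i\<in>{..<n}. u i \<le> 1/2}) - real n / 2) / real n"
            using n by (intro divide_strict_right_mono) auto
          also have "\<dots> = ecdf n u (1/2) - 1/2" using n by (simp add: ecdf_def diff_divide_distrib)
          also have "c * sqrt (real n) / real n = c / sqrt (real n)"
            using n by (simp add: real_div_sqrt divide_simps flip: real_sqrt_mult)
          finally have "c / sqrt (real n) / \<delta> (1/2) < (ecdf n u (1/2) - 1/2) / \<delta> (1/2)"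
            using d by (intro divide_strict_right_mono) auto
          then have "ereal (b n) < ereal ((ecdf n u (1/2) - 1/2) / \<delta> (1/2))"
            using bn by (simp add: mult.commute)
          also have "\<dots> \<le> V_stat n \<delta> u" by (intro V_stat_ge) auto
          finally show "u \<in> {u \<in> space (unif_sample n). V_stat n \<delta> u > ereal (b n)}"
            using us by simp
        qed
        show "{u \<in> space (unif_sample n). V_stat n \<delta> u > ereal (b n)} \<in> events"
          using borel_measurable_V_stat[OF \<delta> n] by measurable
      qed
      also have "\<dots> < \<alpha>" using bs n by (simp add: bounding_seq_def)
      finally show False using le by simp
    qed
  qed (use cp d in auto)
qed

section \<open>Quantiles of a distribution on the unit interval\<close>

lemma real_distribution_unit_interval:
  assumes "real_distribution G" "measure G {0..1} = 1"
  shows "t < 0 \<Longrightarrow> cdf G t = 0" and "1 \<le> t \<Longrightarrow> cdf G t = 1"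
proof -
  interpret real_distribution G by fact
  have "measure G {..t} = 0" if "t < 0"
  proof -
    have "measure G {..t} + measure G {0..1} = measure G ({..t} \<union> {0..1})"
      using that by (intro finite_measure_Union[symmetric]) auto
    also have "\<dots> \<le> 1" by (rule prob_le_1)
    finally show ?thesis using assms measure_nonneg[of G "{..t}"] by linarith
  qed
  then show "t < 0 \<Longrightarrow> cdf G t = 0" by (simp add: cdf_def)
  have "1 \<le> measure G {..t}" if "1 \<le> t"
    using finite_measure_mono[of "{0..1}" "{..t}"] assms that by auto
  then show "1 \<le> t \<Longrightarrow> cdf G t = 1"
    using prob_le_1[of "{..t}"] by (force simp: cdf_def)
qed

text \<open>Right continuity of the cdf gives the lower bound at the infimum, and its left limit
  gives the upper bound for the open ray. The two rays differ because \<open>G\<close> may have an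
  atom at the quantile.\<close>

lemma quantile_props:
  assumes G: "real_distribution G" "measure G {0..1} = 1" and q: "0 < q" "q < 1"
  shows "0 \<le> quantile G q" and "q \<le> cdf G (quantile G q)" and "measure G {..<quantile G q} \<le> q"
proof -
  interpret real_distribution G by fact
  note unit = real_distribution_unit_interval[OF G]
  let ?S = "{t. q \<le> cdf G t}" and ?x = "quantile G q"
  have ne: "1 \<in> ?S" using unit(2)[of 1] q by simp
  have lb: "0 \<le> t" if "t \<in> ?S" for t using unit(1)[of t] q that by (cases "t < 0") auto
  have bdd: "bdd_below ?S" using lb by (auto simp: bdd_below_def)
  show "0 \<le> ?x" unfolding quantile_def using ne lb by (intro cInf_greatest) auto
  have above: "q \<le> cdf G t" if "?x < t" for t
  proof -
    have "?S \<noteq> {}" using ne by (metis empty_iff)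
    then have "\<exists>s\<in>?S. s < t"
      using that cInf_less_iff[of ?S t] bdd by (simp add: quantile_def)
    then obtain s where "s \<in> ?S" "s < t" ..
    then show ?thesis using cdf_nondecreasing[of s t] by auto
  qed
  show "q \<le> cdf G ?x"
  proof (rule tendsto_lowerbound)
    show "(cdf G \<longlongrightarrow> cdf G ?x) (at_right ?x)"
      using cdf_is_right_cont[of ?x] by (simp add: continuous_within)
    show "\<forall>\<^sub>F t in at_right ?x. q \<le> cdf G t"
      using above by (auto simp: eventually_at_right_field intro!: exI[of _ "?x + 1"])
  qed auto
  have below: "cdf G t \<le> q" if "t < ?x" for t
  proof (rule ccontr)
    assume "\<not> cdf G t \<le> q"
    then have "?x \<le> t" unfolding quantile_def using bdd by (intro cInf_lower) auto
    then show False using that by simp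
  qed
  show "measure G {..<?x} \<le> q"
  proof (rule tendsto_upperbound)
    show "(cdf G \<longlongrightarrow> measure G {..<?x}) (at_left ?x)" by (rule cdf_at_left)
    show "\<forall>\<^sub>F t in at_left ?x. cdf G t \<le> q"
      using below by (auto simp: eventually_at_left_field intro!: exI[of _ "?x - 1"])
  qed auto
qed

section \<open>The mixture model\<close>

lemma tendsto_nat_powr_zero: "a < 0 \<Longrightarrow> (\<lambda>n. real n powr a) \<longlonglongrightarrow> 0"
  by (rule tendsto_neg_powr[OF _ filterlim_real_sequentially])

lemma eventually_nat_powr_le:
  assumes "a < b" "0 < (c::real)"
  shows "\<forall>\<^sub>F n in sequentially. K * real n powr a \<le> c * real n powr b"
proof -
  have "(\<lambda>n. K * real n powr (a - b)) \<longlonglongrightarrow> K * 0"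
    using assms by (intro tendsto_mult tendsto_const tendsto_nat_powr_zero) auto
  then have "\<forall>\<^sub>F n in sequentially. K * real n powr (a - b) < c"
    using assms by (auto dest: order_tendstoD)
  then show ?thesis using eventually_gt_at_top[of 0]
  proof eventually_elim
    case (elim n)
    then have "K * real n powr (a - b) * real n powr b \<le> c * real n powr b"
      by (intro mult_right_mono) auto
    also have "K * real n powr (a - b) * real n powr b = K * real n powr a"
      by (simp add: mult.assoc flip: powr_add)
    finally show ?case .
  qed
qed

text \<open>The logarithm is at most \<open>n powr e / e\<close> with \<open>e\<close> the gap
  \<open>b - a\<close>; under the root this costs only half of the gap.\<close>

lemma eventually_sqrt_ln_powr_le:
  assumes "a < b" "0 < (c::real)" "0 \<le> K"
  shows "\<forall>\<^sub>F n in sequentially. K * sqrt (ln (real n) / real n) * real n powr a \<le> c * real n powr (b - 1/2)"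
proof -
  define e where "e = b - a"
  have e: "e > 0" using assms by (simp add: e_def)
  have "\<forall>\<^sub>F n in sequentially. K / sqrt e * real n powr (a + e / 2 - 1/2) \<le> c * real n powr (b - 1/2)"
    using assms by (intro eventually_nat_powr_le) (auto simp: e_def field_simps)
  then show ?thesis using eventually_ge_at_top[of 1]
  proof eventually_elim
    case (elim n)
    have "ln (real n) / real n \<le> (real n powr e / e) / real n"
      using elim e by (intro divide_right_mono ln_powr_bound) auto
    also have "\<dots> = real n powr (e - 1) / e"
      using elim by (simp add: powr_diff)
    finally have "sqrt (ln (real n) / real n) \<le> sqrt (real n powr (e - 1) / e)" by simp
    also have "\<dots> = real n powr (e / 2 - 1/2) / sqrt e"
      by (simp add: real_sqrt_divide powr_half_sqrt[symmetric] powr_powr diff_divide_distrib)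
    finally have "K * sqrt (ln (real n) / real n) * real n powr a
        \<le> K * (real n powr (e / 2 - 1/2) / sqrt e) * real n powr a"
      using assms by (intro mult_left_mono mult_right_mono) auto
    also have "\<dots> = K / sqrt e * real n powr (a + e / 2 - 1/2)"
      by (simp add: powr_add powr_diff mult_ac)
    finally show ?case using elim by linarith
  qed
qed

section \<open>The hypotheses as a locale; orders of magnitude of \<open>lam\<close>,
  \<open>b\<close>, \<open>\<delta>\<close> and the quantiles\<close>

locale sparse_mixture =
  fixes M :: "nat \<Rightarrow> 'a measure"
    and P :: "nat \<Rightarrow> nat \<Rightarrow> 'a \<Rightarrow> real"
    and A :: "nat \<Rightarrow> nat set"
    and G :: "nat \<Rightarrow> real measure"
    and lam \<alpha> :: "nat \<Rightarrow> real"
    and \<beta> :: "real \<Rightarrow> nat \<Rightarrow> real"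
    and \<delta> :: "real \<Rightarrow> real"
    and \<gamma> r \<nu> :: real
  assumes prob_M: "\<And>n. prob_space (M n)"
    and indep: "\<And>n. prob_space.indep_vars (M n) (\<lambda>_. borel) (P n) {..<n}"
    and A_subset: "\<And>n. A n \<subseteq> {..<n}"
    and card_A: "\<And>n. real (card (A n)) = lam n * real n"
    and distr_null: "\<And>n i. i \<in> {..<n} - A n \<Longrightarrow> distr (M n) borel (P n i) = unif01"
    and distr_alt: "\<And>n i. i \<in> A n \<Longrightarrow> distr (M n) borel (P n i) = G n"
    and G_distribution: "\<And>n. real_distribution (G n)"
    and G_unit: "\<And>n. measure (G n) {0..1} = 1"
    and \<gamma>: "\<gamma> \<in> {1/2..<1}"
    and lam_asymp: "\<exists>c>0. (\<lambda>n. real n powr \<gamma> * lam n) \<longlonglongrightarrow> c"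
    and r: "r \<in> {0<..<1}"
    and quantile_asymp: "\<And>q. q \<in> {0<..<1} \<Longrightarrow>
           (\<lambda>n. ln (quantile (G n) q) / (- r * ln (real n))) \<longlonglongrightarrow> 1"
    and \<nu>: "\<nu> \<in> {0..1/2}"
    and Q: "\<delta> \<in> Q_class \<nu>"
    and bounding: "\<And>n. n \<ge> 1 \<Longrightarrow> bounding_seq \<delta> (\<alpha> n) (\<beta> (\<alpha> n))"
    and slowly: "vanishes_slowly \<delta> \<beta> \<alpha>"
begin

definition nulls :: "nat \<Rightarrow> nat set" where "nulls n = {..<n} - A n"

abbreviation b :: "nat \<Rightarrow> real" where "b n \<equiv> \<beta> (\<alpha> n) n"

abbreviation cnt :: "nat \<Rightarrow> nat set \<Rightarrow> real \<Rightarrow> 'a \<Rightarrow> real" where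
  "cnt n K t \<omega> \<equiv> real (card {i\<in>K. P n i \<omega> \<le> t})"

lemma finite_A: "finite (A n)" and finite_nulls: "finite (nulls n)"
  using A_subset[of n] finite_subset by (auto simp: nulls_def)

lemma nulls_Un_A: "nulls n \<union> A n = {..<n}" and nulls_Int_A: "nulls n \<inter> A n = {}"
  using A_subset[of n] by (auto simp: nulls_def)

lemma card_nulls: "real (card (nulls n)) = real n - lam n * real n"
  using card_Diff_subset[OF finite_A A_subset, of n] card_mono[OF _ A_subset, of n] card_A[of n]
  by (simp add: nulls_def of_nat_diff)

lemma rv: "i < n \<Longrightarrow> P n i \<in> borel_measurable (M n)"
  using indep[of n] by (auto simp: prob_space.indep_vars_def[OF prob_M])

lemma ecdf_eq: "ecdf n (\<lambda>i. P n i \<omega>) t = (cnt n (nulls n) t \<omega> + cnt n (A n) t \<omega>) / real n"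
  using card_Un_disjoint_le[OF finite_nulls finite_A nulls_Int_A, of n "\<lambda>i. P n i \<omega>" t]
  by (simp add: ecdf_def nulls_Un_A)

lemma lambda_hat_measurable:
  "(\<lambda>\<omega>. lambda_hat n \<delta> c (\<lambda>i. P n i \<omega>)) \<in> borel_measurable (M n)"
  by (rule borel_measurable_lambda_hat) (rule rv)

lemma lam_bounds:
  obtains c C :: real where "c > 0" "C > 0"
    "\<forall>\<^sub>F n in sequentially. c * real n powr - \<gamma> \<le> lam n \<and> lam n \<le> C * real n powr - \<gamma>"
proof -
  obtain c where c: "c > 0" and lim: "(\<lambda>n. real n powr \<gamma> * lam n) \<longlonglongrightarrow> c" using lam_asymp by auto
  have "\<forall>\<^sub>F n in sequentially. c / 2 < real n powr \<gamma> * lam n \<and> real n powr \<gamma> * lam n < 2 * c"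
    using order_tendstoD(1)[OF lim, of "c / 2"] order_tendstoD(2)[OF lim, of "2 * c"] c
    by (intro eventually_conj) auto
  then have "\<forall>\<^sub>F n in sequentially. c / 2 * real n powr - \<gamma> \<le> lam n \<and> lam n \<le> 2 * c * real n powr - \<gamma>"
    using eventually_gt_at_top[of 0]
  proof eventually_elim
    case (elim n)
    then have "real n powr \<gamma> > 0" by simp
    then show ?case using elim by (simp add: powr_minus field_simps)
  qed
  then show ?thesis using that[of "c / 2" "2 * c"] c by simp
qed

lemma eventually_lam: "\<forall>\<^sub>F n in sequentially. 0 < lam n \<and> lam n < 1"
proof -
  obtain c C :: real where c: "c > 0" "C > 0"
    "\<forall>\<^sub>F n in sequentially. c * real n powr - \<gamma> \<le> lam n \<and> lam n \<le> C * real n powr - \<gamma>"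
    by (rule lam_bounds)
  have "(\<lambda>n. C * real n powr - \<gamma>) \<longlonglongrightarrow> C * 0"
    using \<gamma> by (intro tendsto_mult tendsto_const tendsto_nat_powr_zero) auto
  then have "\<forall>\<^sub>F n in sequentially. C * real n powr - \<gamma> < 1"
    by (rule order_tendstoD(2)) simp
  with c(3) eventually_gt_at_top[of 0] show ?thesis
  proof eventually_elim
    case (elim n)
    then have "0 < c * real n powr - \<gamma>" using c by simp
    then show ?case using elim by linarith
  qed
qed

lemma \<alpha>_lim: "\<alpha> \<longlonglongrightarrow> 0"
  using slowly by (simp add: vanishes_slowly_def)

text \<open>The levels tend to 0, so they eventually fall below the level \<open>p\<close> of
  \<open>bounding_seq_ge\<close>.\<close>

lemma b_lower:
  obtains c where "c > 0" "\<forall>\<^sub>F n in sequentially. c / sqrt (real n) \<le> b n"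
proof -
  obtain c p :: real where cp: "c > 0" "p > 0"
    "\<And>n \<alpha> b. n \<ge> 1 \<Longrightarrow> bounding_seq \<delta> \<alpha> b \<Longrightarrow> \<alpha> \<le> p \<Longrightarrow> c / sqrt (real n) \<le> b n"
    by (rule bounding_seq_ge[OF Q]) blast
  have "\<forall>\<^sub>F n in sequentially. \<alpha> n < p"
    using order_tendstoD(2)[OF \<alpha>_lim cp(2)] .
  then have "\<forall>\<^sub>F n in sequentially. c / sqrt (real n) \<le> b n"
    using eventually_ge_at_top[of 1]
  proof eventually_elim
    case (elim n)
    show ?case by (rule cp(3)) (use elim bounding[of n] in auto)
  qed
  with cp(1) that show ?thesis by blast
qed

lemma eventually_b_pos: "\<forall>\<^sub>F n in sequentially. 0 < b n"
proof -
  obtain c where "c > 0" and c: "\<forall>\<^sub>F n in sequentially. c / sqrt (real n) \<le> b n"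
    by (rule b_lower)
  from c eventually_gt_at_top[of 0] show ?thesis
  proof eventually_elim
    case (elim n)
    then have "0 < c / sqrt (real n)" using \<open>c > 0\<close> by simp
    then show ?case using elim by linarith
  qed
qed

lemma b_upper:
  obtains C where "C > 0" "\<forall>\<^sub>F n in sequentially. b n \<le> C * sqrt (ln (real n) / real n)"
proof -
  have "limsup (\<lambda>n. ereal (sqrt (real n / ln (real n)) * b n)) < \<infinity>"
    using slowly by (simp add: vanishes_slowly_def)
  then obtain C where "limsup (\<lambda>n. ereal (sqrt (real n / ln (real n)) * b n)) < ereal C"
    using less_PInf_Ex_of_nat by fastforce
  then have "\<forall>\<^sub>F n in sequentially. ereal (sqrt (real n / ln (real n)) * b n) < ereal C"
    by (rule Limsup_lessD)
  then have "\<forall>\<^sub>F n in sequentially. b n \<le> max 1 C * sqrt (ln (real n) / real n)"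
    using eventually_gt_at_top[of 1]
  proof eventually_elim
    case (elim n)
    define z where "z = sqrt (real n / ln (real n))"
    have z: "z > 0" using elim by (simp add: z_def)
    have "sqrt (ln (real n) / real n) = 1 / z" using elim by (simp add: z_def real_sqrt_divide)
    moreover have "z * b n \<le> max 1 C" using elim by (auto simp: z_def)
    ultimately show ?case using z by (simp only: pos_le_divide_eq times_divide_eq_right mult_1_right mult.commute)
  qed
  then show ?thesis by (intro that[of "max 1 C"]) auto
qed

text \<open>Local positivity on \<open>{a..c}\<close> requires a bounding sequence at some level at
  most \<open>a\<close>; vanishing levels supply one for every \<open>a > 0\<close>.\<close>

lemma \<delta>_lower:
  assumes "0 < \<kappa>" "\<kappa> \<le> 1/2"
  obtains m where "m > 0" "\<And>t. 0 < t \<Longrightarrow> t < 1 \<Longrightarrow> m * t powr (\<nu> + \<kappa>) * (1 - t) \<le> \<delta> t"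
proof (rule Q_class_lower[OF Q _ _ assms])
  fix a c :: real assume a: "0 < a" "c < 1"
  have "\<forall>\<^sub>F n in sequentially. \<alpha> n < a" using order_tendstoD(2)[OF \<alpha>_lim a(1)] .
  then have "\<forall>\<^sub>F n in sequentially. \<alpha> n < a \<and> n \<ge> 1"
    using eventually_ge_at_top by (rule eventually_conj)
  then obtain n where "\<alpha> n < a" "n \<ge> 1" by (auto simp: eventually_sequentially)
  then show "\<exists>m>0. \<forall>t\<in>{a..c}. m \<le> \<delta> t"
    using a by (intro bounding_seq_local_lower_bound[OF Q bounding[of n]]) auto
qed (use \<nu> that in auto)

lemma eventually_quantile:
  assumes q: "0 < q" "q < 1" and k: "0 < \<kappa>" "\<kappa> < r"
  shows "\<forall>\<^sub>F n in sequentially. real n powr (- r - \<kappa>) \<le> quantile (G n) q \<and>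
      quantile (G n) q \<le> real n powr (- r + \<kappa>)"
proof -
  have lim: "(\<lambda>n. ln (quantile (G n) q) / (- r * ln (real n))) \<longlonglongrightarrow> 1"
    using quantile_asymp q by simp
  have r0: "r > 0" using r by simp
  have "\<forall>\<^sub>F n in sequentially. 1 - \<kappa> / r < ln (quantile (G n) q) / (- r * ln (real n)) \<and>
      ln (quantile (G n) q) / (- r * ln (real n)) < 1 + \<kappa> / r"
    using order_tendstoD(1)[OF lim, of "1 - \<kappa> / r"] order_tendstoD(2)[OF lim, of "1 + \<kappa> / r"] k r0
    by (intro eventually_conj) auto
  then show ?thesis using eventually_gt_at_top[of 1]
  proof eventually_elim
    case (elim n)
    define x where "x = quantile (G n) q"
    define L where "L = ln (real n)"
    have L: "L > 0" using elim by (simp add: L_def)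
    have "x \<ge> 0" unfolding x_def by (rule quantile_props[OF G_distribution G_unit q])
    \<comment> \<open>Since \<open>ln 0 = 0\<close>, a zero quantile would make the ratio 0, which
      lies below the positive number \<open>1 - \<kappa> / r\<close>.\<close>
    moreover have "x \<noteq> 0"
    proof
      assume "x = 0"
      then have "1 - \<kappa> / r < 0" using elim by (simp add: x_def)
      then show False using k r0 by simp
    qed
    ultimately have x: "x > 0" by simp
    have rL: "r * L > 0" using r0 L by simp
    have *: "1 - \<kappa> / r < - (ln x / (r * L))" "- (ln x / (r * L)) < 1 + \<kappa> / r"
      using elim by (auto simp: x_def L_def)
    have "(1 - \<kappa> / r) * (r * L) \<le> - ln x" "- ln x \<le> (1 + \<kappa> / r) * (r * L)"
      using * unfolding minus_divide_left pos_less_divide_eq[OF rL] pos_divide_less_eq[OF rL]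
      by (auto intro: less_imp_le)
    moreover have "(1 - \<kappa> / r) * (r * L) = (r - \<kappa>) * L" "(1 + \<kappa> / r) * (r * L) = (r + \<kappa>) * L"
      using r0 by (auto simp: field_simps)
    ultimately have "exp ((- r - \<kappa>) * L) \<le> exp (ln x)" "exp (ln x) \<le> exp ((- r + \<kappa>) * L)"
      by (auto simp: algebra_simps)
    from this[unfolded exp_ln[OF x]] show ?case using elim by (simp add: powr_def x_def L_def)
  qed
qed

end

section \<open>Exceedances of the null p-values\<close>

lemma tendsto_0_if_eventually_less:
  fixes f :: "nat \<Rightarrow> real"
  assumes "\<And>n. 0 \<le> f n" "\<And>e. e > 0 \<Longrightarrow> \<forall>\<^sub>F n in sequentially. f n < e"
  shows "f \<longlonglongrightarrow> 0"
proof (rule tendstoI)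
  fix e :: real assume "e > 0"
  from assms(2)[OF this] show "\<forall>\<^sub>F n in sequentially. dist (f n) 0 < e"
    by eventually_elim (use assms(1) in simp)
qed

section \<open>The law of the nulls and their crossing event\<close>

context sparse_mixture
begin

text \<open>By independence the nulls jointly follow a product of uniform laws, so crossing
  probabilities can be computed in the uniform sample.\<close>

lemma nulls_law:
  fixes a :: "real \<Rightarrow> real"
  assumes ne: "nulls n \<noteq> {}"
  shows "measure (M n) {\<omega> \<in> space (M n). \<exists>t\<in>T. a t < cnt n (nulls n) t \<omega>}
    = measure (PiM (nulls n) (\<lambda>_. unif01))
        {x \<in> space (PiM (nulls n) (\<lambda>_. unif01)). \<exists>t\<in>T. a t < real (card {i\<in>nulls n. x i \<le> t})}"
proof -
  interpret prob_space "M n" by (rule prob_M)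
  let ?I = "nulls n"
  let ?U = "PiM ?I (\<lambda>_. unif01)" and ?B = "PiM ?I (\<lambda>_. borel :: real measure)"
  let ?X = "\<lambda>\<omega>. \<lambda>i\<in>?I. P n i \<omega>"
  let ?E = "{x \<in> space ?U. \<exists>t\<in>T. a t < real (card {i\<in>?I. x i \<le> t})}"
  have sub: "?I \<subseteq> {..<n}" by (auto simp: nulls_def)
  have rvI: "P n i \<in> borel_measurable (M n)" if "i \<in> ?I" for i using that sub rv by blast
  have "indep_vars (\<lambda>_. borel) (P n) ?I" by (rule indep_vars_subset[OF indep sub])
  then have "distr (M n) ?B ?X = PiM ?I (\<lambda>i. distr (M n) borel (P n i))"
    using indep_vars_iff_distr_eq_PiM'[OF ne, where M' = "\<lambda>_. borel" and X = "P n"] rvI by blast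
  also have "\<dots> = ?U" by (intro PiM_cong refl distr_null) (simp add: nulls_def)
  finally have law: "distr (M n) ?B ?X = ?U" .
  have sets_eq: "sets ?U = sets ?B" by (intro sets_PiM_cong) auto
  have E: "?E \<in> sets ?U"
    using finite_nulls borel_measurable_PiM_unif01 by (intro sets_Ex_less_card_le) auto
  have X: "?X \<in> measurable (M n) ?B" using rvI by (intro measurable_restrict) auto
  have "measure ?U ?E = measure (distr (M n) ?B ?X) ?E" by (simp only: law)
  also have "\<dots> = measure (M n) (?X -` ?E \<inter> space (M n))"
    using E X by (intro measure_distr) (auto simp: sets_eq)
  also have "?X -` ?E \<inter> space (M n) = {\<omega> \<in> space (M n). \<exists>t\<in>T. a t < cnt n ?I t \<omega>}"
  proof -
    have "{i\<in>?I. ?X \<omega> i \<le> t} = {i\<in>?I. P n i \<omega> \<le> t}" for \<omega> t by auto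
    moreover have "?X \<omega> \<in> space ?U" for \<omega>
      by (simp add: space_PiM space_uniform_measure PiE_iff)
    ultimately show ?thesis by auto
  qed
  finally show ?thesis ..
qed

text \<open>Shaped as the event in \<open>prob_crossing_subsample\<close> with
  \<open>I = nulls n\<close>, \<open>J = A n\<close>: the indices of the false nulls are the ones to
  be filled with fresh uniforms.\<close>

definition cross :: "real \<Rightarrow> real \<Rightarrow> nat \<Rightarrow> 'a set" where
  "cross \<eta> \<epsilon> n = {\<omega> \<in> space (M n). \<exists>t\<in>{0<..<1}.
     real n * (\<eta> * b n * \<delta> t) + real (card (nulls n)) * t + \<epsilon> * real (card (A n)) * (1 - t)
       < cnt n (nulls n) t \<omega>}"

lemma sets_cross: "cross \<eta> \<epsilon> n \<in> sets (M n)"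
  unfolding cross_def using finite_nulls rv by (intro sets_Ex_less_card_le) (auto simp: nulls_def)

text \<open>After completion to a full uniform sample a crossing forces
  \<open>V_stat n \<delta> > \<eta> * b n\<close>, which is asymptotically negligible; completing
  costs only the fixed factor \<open>(1 + \<epsilon>) / \<epsilon>\<close>.\<close>

lemma cross_tendsto:
  assumes \<eta>: "\<eta> > 0" and e: "\<epsilon> > 0"
  shows "(\<lambda>n. measure (M n) (cross \<eta> \<epsilon> n)) \<longlonglongrightarrow> 0"
proof -
  \<comment> \<open>Half of \<open>\<eta>\<close> leaves room for the strict inequality, as division
    of extended reals is used in its weakly monotone form.\<close>
  define V where "V n = measure (unif_sample n) {u \<in> space (unif_sample n).
      ereal (\<eta> / 2) < \<bar>V_stat n \<delta> u / ereal (b n) - 0\<bar>}" for n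
  have "V \<longlonglongrightarrow> 0"
    using slowly \<eta> unfolding vanishes_slowly_def tendsto_in_prob_def V_def by auto
  then have lim: "(\<lambda>n. (1 + \<epsilon>) / \<epsilon> * V n) \<longlonglongrightarrow> 0"
    using tendsto_mult_right_zero by blast
  have "\<forall>\<^sub>F n in sequentially. measure (M n) (cross \<eta> \<epsilon> n) \<le> (1 + \<epsilon>) / \<epsilon> * V n"
    using eventually_b_pos eventually_lam eventually_ge_at_top[of 1]
  proof eventually_elim
    case (elim n)
    let ?I = "nulls n" and ?J = "A n"
    interpret prob_space "unif_sample n" unfolding unif_sample_def by (rule prob_space_PiM_unif01)
    have "real (card ?I) > 0" using elim by (simp add: card_nulls)
    then have ne: "?I \<noteq> {}" by auto
    define a where "a t = real n * (\<eta> * b n * \<delta> t)" for t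
    have "\<epsilon> / (1 + \<epsilon>) * measure (M n) (cross \<eta> \<epsilon> n)
      \<le> prob {u\<in>space (unif_sample n). \<exists>t\<in>{0<..<1}. a t + real n * t < real (card {i\<in>{..<n}. u i \<le> t})}"
      using prob_crossing_subsample[OF finite_nulls[of n] finite_A[of n] nulls_Int_A e, of a]
      unfolding cross_def nulls_law[OF ne] a_def[symmetric] nulls_Un_A unif_sample_def by simp
    also have "\<dots> \<le> V n"
      unfolding V_def
    proof (rule finite_measure_mono)
      show "{u\<in>space (unif_sample n). \<exists>t\<in>{0<..<1}. a t + real n * t < real (card {i\<in>{..<n}. u i \<le> t})}
        \<subseteq> {u \<in> space (unif_sample n). ereal (\<eta> / 2) < \<bar>V_stat n \<delta> u / ereal (b n) - 0\<bar>}"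
      proof
        fix u assume "u \<in> {u\<in>space (unif_sample n). \<exists>t\<in>{0<..<1}. a t + real n * t < real (card {i\<in>{..<n}. u i \<le> t})}"
        then obtain t where us: "u \<in> space (unif_sample n)" and t: "0 < t" "t < 1"
          and "a t + real n * t < real (card {i\<in>{..<n}. u i \<le> t})" by auto
        then have "\<eta> * b n * \<delta> t < ecdf n u t - t"
          using elim by (simp add: a_def ecdf_def field_simps)
        then have *: "\<eta> * b n < (ecdf n u t - t) / \<delta> t"
          using Q_classD(1)[OF Q t] by (simp add: field_simps)
        have "ereal (\<eta> / 2) < ereal \<eta>" using \<eta> by simp
        also have "\<dots> = ereal (\<eta> * b n) / ereal (b n)" using elim by simp
        also have "\<dots> \<le> ereal ((ecdf n u t - t) / \<delta> t) / ereal (b n)"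
          using * elim by (intro ereal_divide_right_mono) auto
        also have "\<dots> \<le> V_stat n \<delta> u / ereal (b n)"
          using elim by (intro ereal_divide_right_mono V_stat_ge t) auto
        also have "\<dots> \<le> \<bar>V_stat n \<delta> u / ereal (b n)\<bar>" by (cases "V_stat n \<delta> u / ereal (b n)") auto
        finally show "u \<in> {u \<in> space (unif_sample n). ereal (\<eta> / 2) < \<bar>V_stat n \<delta> u / ereal (b n) - 0\<bar>}"
          using us by simp
      qed
      have "(\<lambda>u. V_stat n \<delta> u / ereal (b n)) \<in> borel_measurable (unif_sample n)"
        using slowly unfolding vanishes_slowly_def tendsto_in_prob_def by auto
      then show "{u \<in> space (unif_sample n). ereal (\<eta> / 2) < \<bar>V_stat n \<delta> u / ereal (b n) - 0\<bar>} \<in> events"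
        by measurable
    qed
    finally show ?case using e by (simp add: field_simps)
  qed
  then show ?thesis
    by (intro tendsto_sandwich[OF _ _ tendsto_const lim]) auto
qed

section \<open>Counts in a fixed set\<close>

text \<open>Markov's inequality with a bound free of \<open>n\<close>; \<open>p\<close> is made
  small later through the quantile level.\<close>

lemma A_count_ge:
  assumes B: "B \<in> sets borel" and p: "measure (G n) B \<le> p" and e: "0 < \<epsilon>" and lam: "0 < lam n" "n \<ge> 1"
  shows "measure (M n) {\<omega>\<in>space (M n). \<epsilon> * (lam n * real n) \<le> real (card {i\<in>A n. P n i \<omega> \<in> B})} \<le> p / \<epsilon>"
proof -
  interpret prob_space "M n" by (rule prob_M)
  have *: "P n i \<in> borel_measurable (M n)" if "i \<in> A n" for i using that A_subset rv by blast
  have "prob {\<omega>\<in>space (M n). P n i \<omega> \<in> B} \<le> p" if "i \<in> A n" for i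
  proof -
    have "measure (G n) B = measure (distr (M n) borel (P n i)) B" using distr_alt[OF that] by simp
    also have "\<dots> = prob (P n i -` B \<inter> space (M n))" using *[OF that] B by (rule measure_distr)
    also have "P n i -` B \<inter> space (M n) = {\<omega>\<in>space (M n). P n i \<omega> \<in> B}" by auto
    finally show ?thesis using p by simp
  qed
  then have "prob {\<omega>\<in>space (M n). \<epsilon> * (lam n * real n) \<le> real (card {i\<in>A n. P n i \<omega> \<in> B})}
      \<le> real (card (A n)) * p / (\<epsilon> * (lam n * real n))"
    using e lam by (intro prob_card_ge_le finite_A * B) auto
  also have "\<dots> = p / \<epsilon>" using lam by (simp add: card_A)
  finally show ?thesis .
qed

lemma sets_A_count: "B \<in> sets borel \<Longrightarrow>
  {\<omega>\<in>space (M n). c \<le> real (card {i\<in>A n. P n i \<omega> \<in> B})} \<in> sets (M n)"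
proof -
  assume B: "B \<in> sets borel"
  have *: "P n i \<in> borel_measurable (M n)" if "i \<in> A n" for i using that A_subset rv by blast
  have "(\<lambda>\<omega>. \<Sum>i\<in>A n. indicat_real B (P n i \<omega>)) \<in> borel_measurable (M n)"
    using * B by (intro borel_measurable_sum) auto
  then show ?thesis unfolding of_nat_card_eq_sum_indicator[OF finite_A] by measurable
qed

text \<open>Chebyshev's inequality, for the one evaluation point of the lower bound on the
  estimator.\<close>

lemma nulls_count_le:
  assumes s: "0 < s" "s < 1" and c: "0 < c"
  shows "measure (M n) {\<omega>\<in>space (M n). cnt n (nulls n) s \<omega> \<le> real (card (nulls n)) * s - c}
    \<le> real (card (nulls n)) * s / c\<^sup>2"
proof -
  interpret prob_space "M n" by (rule prob_M)
  have *: "P n i \<in> borel_measurable (M n)" if "i \<in> nulls n" for i using that rv by (auto simp: nulls_def)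
  have "prob {\<omega>\<in>space (M n). P n i \<omega> \<in> {..s}} = s" if "i \<in> nulls n" for i
  proof -
    have "s = measure (distr (M n) borel (P n i)) {..s}"
      using distr_null[of i n] that s measure_unif01_atMost[of s] by (simp add: nulls_def)
    also have "\<dots> = prob (P n i -` {..s} \<inter> space (M n))" using *[OF that] by (rule measure_distr) simp
    also have "P n i -` {..s} \<inter> space (M n) = {\<omega>\<in>space (M n). P n i \<omega> \<in> {..s}}" by auto
    finally show ?thesis by simp
  qed
  moreover have "indep_vars (\<lambda>_. borel) (P n) (nulls n)"
    by (rule indep_vars_subset[OF indep]) (auto simp: nulls_def)
  ultimately show ?thesis
    using prob_card_le_le[OF finite_nulls, of "P n" n "{..s}" s c] c by simp
qed

lemma sets_nulls_count: "{\<omega>\<in>space (M n). cnt n (nulls n) s \<omega> \<le> c} \<in> sets (M n)"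
proof -
  have *: "P n i \<in> borel_measurable (M n)" if "i \<in> nulls n" for i using that rv by (auto simp: nulls_def)
  have "(\<lambda>\<omega>. \<Sum>i\<in>nulls n. indicat_real {..s} (P n i \<omega>)) \<in> borel_measurable (M n)"
    using * by (intro borel_measurable_sum) auto
  then show ?thesis
    using of_nat_card_eq_sum_indicator[OF finite_nulls, of _ _ "{..s}"] by simp
qed

end

section \<open>Upper tails of the estimator\<close>

context sparse_mixture
begin

definition lhat :: "nat \<Rightarrow> 'a \<Rightarrow> ereal" where
  "lhat n \<omega> = lambda_hat n \<delta> (b n) (\<lambda>i. P n i \<omega>)"

lemma lhat_measurable [measurable]: "lhat n \<in> borel_measurable (M n)"
  using lambda_hat_measurable[of n "b n"] by (simp add: lhat_def[abs_def])

lemma lhat_ge: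
  "0 < t \<Longrightarrow> t < 1 \<Longrightarrow> ereal ((ecdf n (\<lambda>i. P n i \<omega>) t - t - b n * \<delta> t) / (1 - t)) \<le> lhat n \<omega>"
  unfolding lhat_def lambda_hat_def by (intro SUP_upper) auto

lemma lhat_gtE:
  assumes "ereal x < lhat n \<omega>"
  obtains t where "0 < t" "t < 1" "x * (1 - t) < ecdf n (\<lambda>i. P n i \<omega>) t - t - b n * \<delta> t"
  using assms unfolding lhat_def lambda_hat_def less_SUP_iff by (auto simp: pos_less_divide_eq)

lemma cnt_A_le: "cnt n (A n) t \<omega> \<le> lam n * real n"
  using card_mono[OF finite_A, of "{i\<in>A n. P n i \<omega> \<le> t}" n] card_A[of n] by simp

lemma notin_crossD:
  assumes "\<omega> \<in> space (M n)" "\<omega> \<notin> cross \<eta> \<epsilon> n" "0 < t" "t < 1"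
  shows "cnt n (nulls n) t \<omega>
    \<le> real n * (\<eta> * b n * \<delta> t) + (real n - lam n * real n) * t + \<epsilon> * (lam n * real n) * (1 - t)"
  using assms by (force simp: cross_def card_nulls card_A)

text \<open>The nulls make up only the share \<open>1 - lam n\<close>, so centring the whole by
  \<open>t\<close> leaves \<open>- lam n * t\<close>. Used with \<open>c = 1\<close> for all false
  nulls and with \<open>c = \<epsilon>\<close> left of a low quantile.\<close>

lemma ecdf_excess_le:
  assumes n: "n \<ge> 1" and \<omega>: "\<omega> \<in> space (M n)" "\<omega> \<notin> cross \<eta> \<epsilon> n" and t: "0 < t" "t < 1"
    and c: "cnt n (A n) t \<omega> \<le> c * (lam n * real n)"
  shows "ecdf n (\<lambda>i. P n i \<omega>) t - t \<le> \<eta> * b n * \<delta> t + lam n * (c - t) + \<epsilon> * lam n * (1 - t)"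
proof -
  have "real n * (ecdf n (\<lambda>i. P n i \<omega>) t - t) = cnt n (nulls n) t \<omega> + cnt n (A n) t \<omega> - real n * t"
    using n by (simp add: ecdf_eq field_simps)
  also have "\<dots> \<le> real n * (\<eta> * b n * \<delta> t + lam n * (c - t) + \<epsilon> * lam n * (1 - t))"
    using notin_crossD[OF \<omega> t] c by (simp add: algebra_simps)
  finally show ?thesis using n by simp
qed

text \<open>With \<open>\<eta> = 1\<close> the penalty of the estimator absorbs the nulls, and the
  remainder \<open>(1 + \<epsilon>) * lam n * (1 - t)\<close> is normalised by the denominator.
  Valid on both sides of the boundary.\<close>

lemma lhat_exceeds_tendsto:
  assumes e: "\<epsilon> > 0"
  shows "(\<lambda>n. measure (M n) {\<omega>\<in>space (M n). ereal ((1 + \<epsilon>) * lam n) < lhat n \<omega>}) \<longlonglongrightarrow> 0"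
proof (rule tendsto_sandwich[OF _ _ tendsto_const cross_tendsto[OF zero_less_one e]])
  show "\<forall>\<^sub>F n in sequentially. measure (M n) {\<omega>\<in>space (M n). ereal ((1 + \<epsilon>) * lam n) < lhat n \<omega>}
      \<le> measure (M n) (cross 1 \<epsilon> n)"
    using eventually_ge_at_top[of 1]
  proof eventually_elim
    case (elim n)
    interpret prob_space "M n" by (rule prob_M)
    show ?case
    proof (rule finite_measure_mono[OF _ sets_cross])
      show "{\<omega>\<in>space (M n). ereal ((1 + \<epsilon>) * lam n) < lhat n \<omega>} \<subseteq> cross 1 \<epsilon> n"
      proof (rule subsetI, rule ccontr)
        fix \<omega> assume "\<omega> \<in> {\<omega>\<in>space (M n). ereal ((1 + \<epsilon>) * lam n) < lhat n \<omega>}" and nc: "\<omega> \<notin> cross 1 \<epsilon> n"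
        then have \<omega>: "\<omega> \<in> space (M n)" and gt: "ereal ((1 + \<epsilon>) * lam n) < lhat n \<omega>" by auto
        obtain t where t: "0 < t" "t < 1"
          and "(1 + \<epsilon>) * lam n * (1 - t) < ecdf n (\<lambda>i. P n i \<omega>) t - t - b n * \<delta> t"
          using lhat_gtE[OF gt] .
        moreover have "ecdf n (\<lambda>i. P n i \<omega>) t - t \<le> 1 * b n * \<delta> t + lam n * (1 - t) + \<epsilon> * lam n * (1 - t)"
          using cnt_A_le by (intro ecdf_excess_le elim \<omega> nc t) simp
        ultimately show False by (simp add: algebra_simps)
      qed
    qed
  qed
qed auto

text \<open>Right of the quantile \<open>t \<ge> n powr (- r - \<kappa>)\<close>, so the penalty per
  \<open>1 - t\<close> is at least of order
  \<open>n powr (- 1/2 - (r + \<kappa>) * (\<nu> + \<kappa>))\<close>, which beats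
  \<open>n powr - \<gamma>\<close>. The factor 4 lets half of the penalty absorb
  \<open>2 * lam n * (1 - t)\<close>.\<close>

lemma boundary_dominates:
  assumes "\<nu> * r < \<gamma> - 1/2" and q: "0 < q" "q < 1"
  shows "\<forall>\<^sub>F n in sequentially. \<forall>t. quantile (G n) q \<le> t \<and> 0 < t \<and> t < 1 \<longrightarrow>
      4 * lam n * (1 - t) \<le> b n * \<delta> t"
proof -
  define D where "D = \<gamma> - 1/2 - \<nu> * r"
  \<comment> \<open>The perturbed exponent loses \<open>\<kappa> * (r + \<nu> + \<kappa>) \<le> 2 *
    \<kappa> \<le> D / 2\<close>. The other two caps are those of \<open>\<delta>_lower\<close> and
    \<open>eventually_quantile\<close>.\<close>
  define \<kappa> where "\<kappa> = min (min (1/2) (D / 4)) (r / 2)"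
  have D: "D > 0" using assms by (simp add: D_def)
  have k: "0 < \<kappa>" "\<kappa> \<le> 1/2" "\<kappa> \<le> D / 4" "\<kappa> < r" using D r by (auto simp: \<kappa>_def)
  have "\<kappa> * (r + \<nu> + \<kappa>) \<le> \<kappa> * 2" using k r \<nu> by (intro mult_left_mono) auto
  then have expo: "- \<gamma> < - 1/2 + (- r - \<kappa>) * (\<nu> + \<kappa>)"
    using D k by (simp add: D_def algebra_simps)
  obtain m where m: "m > 0" "\<And>t. 0 < t \<Longrightarrow> t < 1 \<Longrightarrow> m * t powr (\<nu> + \<kappa>) * (1 - t) \<le> \<delta> t"
    by (rule \<delta>_lower[OF k(1,2)]) blast
  obtain c where c: "c > 0" "\<forall>\<^sub>F n in sequentially. c / sqrt (real n) \<le> b n" by (rule b_lower)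
  obtain c1 C1 where C1: "\<forall>\<^sub>F n in sequentially. c1 * real n powr - \<gamma> \<le> lam n \<and> lam n \<le> C1 * real n powr - \<gamma>"
    by (rule lam_bounds)
  have "\<forall>\<^sub>F n in sequentially. 4 * C1 * real n powr - \<gamma> \<le> (c * m) * real n powr (- 1/2 + (- r - \<kappa>) * (\<nu> + \<kappa>))"
    using c m expo by (intro eventually_nat_powr_le) auto
  with eventually_quantile[OF q k(1,4)] c(2) C1 eventually_ge_at_top[of 1]
  show ?thesis
  proof eventually_elim
    case (elim n)
    show ?case
    proof (intro allI impI, elim conjE)
      fix t assume t: "quantile (G n) q \<le> t" "0 < t" "t < 1"
      have n0: "real n > 0" using elim by simp
      have "real n powr (- r - \<kappa>) \<le> t" using elim t by linarith
      then have tp: "(real n powr (- r - \<kappa>)) powr (\<nu> + \<kappa>) \<le> t powr (\<nu> + \<kappa>)"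
        using k \<nu> by (intro powr_mono2) auto
      have "4 * lam n \<le> 4 * C1 * real n powr - \<gamma>" using elim by simp
      also have "\<dots> \<le> (c * m) * real n powr (- 1/2 + (- r - \<kappa>) * (\<nu> + \<kappa>))" using elim by simp
      also have "real n powr (- 1/2 + (- r - \<kappa>) * (\<nu> + \<kappa>))
          = 1 / sqrt (real n) * (real n powr (- r - \<kappa>)) powr (\<nu> + \<kappa>)"
        unfolding powr_powr powr_add[of "real n" "- 1/2"] using powr_minus_divide[of "real n" "1/2"] powr_half_sqrt[of "real n"] by simp
      also have "(c * m) * (1 / sqrt (real n) * (real n powr (- r - \<kappa>)) powr (\<nu> + \<kappa>))
          = (c / sqrt (real n)) * (m * (real n powr (- r - \<kappa>)) powr (\<nu> + \<kappa>))" by simp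
      also have "\<dots> \<le> (c / sqrt (real n)) * (m * t powr (\<nu> + \<kappa>))"
        using c m tp by (intro mult_left_mono) auto
      finally have "4 * lam n * (1 - t) \<le> (c / sqrt (real n)) * (m * t powr (\<nu> + \<kappa>)) * (1 - t)"
        using t by (intro mult_right_mono) auto
      also have "\<dots> = (c / sqrt (real n)) * (m * t powr (\<nu> + \<kappa>) * (1 - t))" by simp
      also have "\<dots> \<le> b n * \<delta> t"
        using elim c m t n0 order_trans[of 0 "c / sqrt (real n)" "b n"] by (intro mult_mono) auto
      finally show "4 * lam n * (1 - t) \<le> b n * \<delta> t" .
    qed
  qed
qed

text \<open>A witness of a large estimator lies on one side of the low quantile: on the left few
  false nulls have been counted, on the right the penalty wins.\<close>

lemma lhat_exceeds_small_tendsto: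
  assumes gap: "\<nu> * r < \<gamma> - 1/2" and e: "0 < \<epsilon>" "\<epsilon> \<le> 1"
  shows "(\<lambda>n. measure (M n) {\<omega>\<in>space (M n). ereal (2 * \<epsilon> * lam n) < lhat n \<omega>}) \<longlonglongrightarrow> 0"
proof (rule tendsto_0_if_eventually_less)
  fix x :: real assume x: "x > 0"
  \<comment> \<open>Markov's bound for the false nulls left of the quantile is
    \<open>q / \<epsilon>\<close>, allotted \<open>x / 2\<close>; the crossing event takes the other
    half.\<close>
  define q where "q = min (1/2) (\<epsilon> * x / 2)"
  have q: "0 < q" "q < 1" "q / \<epsilon> \<le> x / 2" using e x by (auto simp: q_def min_def field_simps)
  have "\<forall>\<^sub>F n in sequentially. measure (M n) (cross (1/2) \<epsilon> n) < x / 2"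
    using cross_tendsto[of "1/2", OF _ e(1)] x by (intro order_tendstoD(2)) auto
  with boundary_dominates[OF gap q(1,2)] eventually_lam eventually_b_pos eventually_ge_at_top[of 1]
  show "\<forall>\<^sub>F n in sequentially. measure (M n) {\<omega>\<in>space (M n). ereal (2 * \<epsilon> * lam n) < lhat n \<omega>} < x"
  proof eventually_elim
    case (elim n)
    interpret prob_space "M n" by (rule prob_M)
    define tq where "tq = quantile (G n) q"
    define B where "B = {\<omega>\<in>space (M n). \<epsilon> * (lam n * real n) \<le> real (card {i\<in>A n. P n i \<omega> \<in> {..<tq}})}"
    have B: "B \<in> events" unfolding B_def by (rule sets_A_count) simp
    have "measure (G n) {..<tq} \<le> q"
      unfolding tq_def by (rule quantile_props(3)[OF G_distribution G_unit q(1,2)])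
    then have pB: "prob B \<le> q / \<epsilon>"
      unfolding B_def by (intro A_count_ge) (use elim(2,4) e in simp_all)
    have "{\<omega>\<in>space (M n). ereal (2 * \<epsilon> * lam n) < lhat n \<omega>} \<subseteq> cross (1/2) \<epsilon> n \<union> B"
    proof (rule subsetI, rule ccontr)
      fix \<omega> assume "\<omega> \<in> {\<omega>\<in>space (M n). ereal (2 * \<epsilon> * lam n) < lhat n \<omega>}" "\<omega> \<notin> cross (1/2) \<epsilon> n \<union> B"
      then have \<omega>: "\<omega> \<in> space (M n)" "\<omega> \<notin> cross (1/2) \<epsilon> n" and nB: "\<omega> \<notin> B"
        and gt: "ereal (2 * \<epsilon> * lam n) < lhat n \<omega>" by auto
      obtain t where t: "0 < t" "t < 1"
        and big: "2 * \<epsilon> * lam n * (1 - t) < ecdf n (\<lambda>i. P n i \<omega>) t - t - b n * \<delta> t"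
        using lhat_gtE[OF gt] .
      show False
      proof (cases "t < tq")
        case True
        have "card {i\<in>A n. P n i \<omega> \<le> t} \<le> card {i\<in>A n. P n i \<omega> \<in> {..<tq}}"
          using True finite_A by (intro card_mono) auto
        then have "cnt n (A n) t \<omega> \<le> \<epsilon> * (lam n * real n)" using nB \<omega> by (auto simp: B_def)
        then have "ecdf n (\<lambda>i. P n i \<omega>) t - t \<le> 1/2 * b n * \<delta> t + lam n * (\<epsilon> - t) + \<epsilon> * lam n * (1 - t)"
          using elim by (intro ecdf_excess_le \<omega> t) auto
        \<comment> \<open>Uses \<open>\<epsilon> * t \<le> t\<close>; the two terms together give
          exactly \<open>2 * \<epsilon> * lam n * (1 - t)\<close>.\<close>
        moreover have "lam n * (\<epsilon> - t) \<le> lam n * (\<epsilon> * (1 - t))"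
          using elim e t mult_left_le_one_le[of t \<epsilon>] by (intro mult_left_mono) (auto simp: algebra_simps)
        moreover have "0 \<le> b n * \<delta> t"
          using elim Q_classD(1)[OF Q t] by simp
        ultimately show False using big by (simp add: algebra_simps)
      next
        case False
        have "ecdf n (\<lambda>i. P n i \<omega>) t - t \<le> 1/2 * b n * \<delta> t + lam n * (1 - t) + \<epsilon> * lam n * (1 - t)"
          using cnt_A_le elim by (intro ecdf_excess_le \<omega> t) simp_all
        moreover have "4 * lam n * (1 - t) \<le> b n * \<delta> t"
          using elim(1) False t by (auto simp: tq_def)
        moreover have "\<epsilon> * lam n * (1 - t) \<le> 1 * lam n * (1 - t)"
          using e elim t by (intro mult_right_mono) auto
        moreover have "0 \<le> \<epsilon> * lam n * (1 - t)" using e elim t by auto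
        ultimately show False using big by (simp add: algebra_simps)
      qed
    qed
    then have "prob {\<omega>\<in>space (M n). ereal (2 * \<epsilon> * lam n) < lhat n \<omega>} \<le> prob (cross (1/2) \<epsilon> n \<union> B)"
      using B sets_cross by (intro finite_measure_mono) auto
    also have "\<dots> \<le> prob (cross (1/2) \<epsilon> n) + prob B"
      using B sets_cross by (intro measure_Un_le) auto
    also have "\<dots> < x" using elim(5) pB q(3) by linarith
    finally show ?case .
  qed
qed auto

end

section \<open>Lower tails of the estimator and the two regimes\<close>

context sparse_mixture
begin

text \<open>The point must lie beyond a high quantile to count most false nulls, be an orbit point
  so that \<open>\<delta>\<close> is controlled, and be so small that both \<open>lam n * s\<close>
  and the standard deviation \<open>sqrt (n * s)\<close> of the null count are negligible.\<close>

lemma eventually_good_point: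
  assumes "\<nu> * r > \<gamma> - 1/2" and q: "0 < q" "q < 1" and e: "0 < \<epsilon>" and x: "0 < x"
  shows "\<forall>\<^sub>F n in sequentially. \<exists>s. 0 < s \<and> s < 1 \<and> q \<le> cdf (G n) s \<and> s \<le> \<epsilon> \<and>
      b n * \<delta> s \<le> \<epsilon> * lam n \<and> real n * s \<le> x * (lam n * real n)\<^sup>2"
proof -
  define D where "D = \<nu> * r - \<gamma> + 1/2"
  \<comment> \<open>The cap \<open>D / 4\<close> keeps the exponent \<open>d\<close> of
    \<open>\<delta> s\<close> below \<open>1/2 - \<gamma> = D - \<nu> * r\<close>.\<close>
  define \<kappa> where "\<kappa> = min (min (1/2) (D / 4)) (r / 2)"
  have D: "D > 0" using assms by (simp add: D_def)
  have k: "0 < \<kappa>" "\<kappa> \<le> 1/2" "\<kappa> \<le> D / 4" "\<kappa> < r" using D r by (auto simp: \<kappa>_def)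
  \<comment> \<open>Bounds the exponent of \<open>s powr (\<nu> - \<kappa>)\<close>. As
    \<open>\<nu> - \<kappa>\<close> may be negative, \<open>s powr \<nu>\<close> is estimated from
    the upper end of the range of \<open>s\<close> and \<open>s powr - \<kappa>\<close> from the
    lower end.\<close>
  define d where "d = - \<nu> * r + 2 * \<kappa>"
  define w where "w = \<nu> * r"
  \<comment> \<open>Since \<open>\<nu> \<le> 1/2\<close>, also
    \<open>r \<ge> 2 * \<nu> * r = 2 * \<gamma> - 1 + 2 * D\<close>, which makes the null variance
    \<open>n * s\<close> small against \<open>(lam n * n)^2\<close>.\<close>
  have "w \<le> 1/2 * r" unfolding w_def using r \<nu> by (intro mult_right_mono) auto
  moreover have "D = w - \<gamma> + 1/2" by (simp add: D_def w_def)
  ultimately have expo: "- r + \<kappa> < - 2 * \<gamma> + 1"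
    using D k by linarith
  have expo1: "d < 1/2 - \<gamma>"
    using D k by (simp add: d_def D_def)
  have "\<kappa> * (r + \<nu> + \<kappa>) \<le> \<kappa> * 2" using k r \<nu> by (intro mult_left_mono) auto
  then have expo2: "(- r + \<kappa>) * \<nu> + (- r - \<kappa>) * (- \<kappa>) \<le> d"
    by (simp add: d_def algebra_simps)
  obtain C t0 where C: "C > 0" "0 < t0" "t0 < 1/2"
    "\<And>t. 0 < t \<Longrightarrow> t < t0 \<Longrightarrow> \<exists>s\<ge>t. s \<le> 2 * t \<and> s \<le> t0 \<and> \<delta> s \<le> C * s powr (\<nu> - \<kappa>)"
    by (rule Q_class_dyadic_upper[OF Q k(1)]) blast
  obtain K where K: "K > 0" "\<forall>\<^sub>F n in sequentially. b n \<le> K * sqrt (ln (real n) / real n)" by (rule b_upper)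
  obtain c C1 where c: "c > 0"
    and lam: "\<forall>\<^sub>F n in sequentially. c * real n powr - \<gamma> \<le> lam n \<and> lam n \<le> C1 * real n powr - \<gamma>"
    by (rule lam_bounds)
  have ev1: "\<forall>\<^sub>F n in sequentially. 2 * real n powr (- r + \<kappa>) \<le> min (t0 / 2) \<epsilon> * real n powr 0"
    using C e k by (intro eventually_nat_powr_le) auto
  have ev2: "\<forall>\<^sub>F n in sequentially. (K * C * 2) * sqrt (ln (real n) / real n) * real n powr d
      \<le> (\<epsilon> * c) * real n powr ((1/2 - \<gamma>) - 1/2)"
    using expo1 e c K C by (intro eventually_sqrt_ln_powr_le) auto
  have ev3: "\<forall>\<^sub>F n in sequentially. 2 * real n powr (- r + \<kappa>) \<le> (x * c\<^sup>2) * real n powr (- 2 * \<gamma> + 1)"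
    using expo x c by (intro eventually_nat_powr_le) auto
  from eventually_quantile[OF q k(1,4)] K(2) lam ev1 ev2 ev3 eventually_b_pos eventually_ge_at_top[of 1]
  show ?thesis
  proof eventually_elim
    case (elim n)
    define t where "t = quantile (G n) q"
    have n: "real n \<ge> 1" using elim by simp
    have tb: "real n powr (- r - \<kappa>) \<le> t" "t \<le> real n powr (- r + \<kappa>)" using elim by (auto simp: t_def)
    have t0: "0 < t" using tb(1) n by (intro less_le_trans[OF _ tb(1)]) simp
    have small: "2 * real n powr (- r + \<kappa>) \<le> t0 / 2" "2 * real n powr (- r + \<kappa>) \<le> \<epsilon>"
      using elim(4) n by auto
    have "t < t0" using tb(2) small(1) C(2) t0 by linarith
    then obtain s where s: "t \<le> s" "s \<le> 2 * t" "s \<le> t0" "\<delta> s \<le> C * s powr (\<nu> - \<kappa>)"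
      using C(4)[OF t0] by auto
    have s0: "0 < s" "s < 1" using s t0 C by auto
    have sb: "real n powr (- r - \<kappa>) \<le> s" "s \<le> 2 * real n powr (- r + \<kappa>)" using tb s by linarith+
    have "q \<le> cdf (G n) t" unfolding t_def by (rule quantile_props(2)[OF G_distribution G_unit q])
    also have "\<dots> \<le> cdf (G n) s"
    proof -
      interpret real_distribution "G n" by (rule G_distribution)
      show ?thesis using s by (intro cdf_nondecreasing)
    qed
    finally have qs: "q \<le> cdf (G n) s" .
    have "s powr \<nu> \<le> (2 * real n powr (- r + \<kappa>)) powr \<nu>"
      using s0 sb \<nu> by (intro powr_mono2) auto
    also have "\<dots> = 2 powr \<nu> * real n powr ((- r + \<kappa>) * \<nu>)" by (simp add: powr_mult powr_powr)
    also have "\<dots> \<le> 2 * real n powr ((- r + \<kappa>) * \<nu>)"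
      using powr_mono[of \<nu> 1 "2::real"] \<nu> by (intro mult_right_mono) auto
    finally have s1: "s powr \<nu> \<le> 2 * real n powr ((- r + \<kappa>) * \<nu>)" .
    have "s powr - \<kappa> \<le> (real n powr (- r - \<kappa>)) powr - \<kappa>"
      using sb n k by (intro powr_mono2') auto
    then have s2: "s powr - \<kappa> \<le> real n powr ((- r - \<kappa>) * (- \<kappa>))" by (simp add: powr_powr)
    have "s powr (\<nu> - \<kappa>) = s powr \<nu> * s powr - \<kappa>" using powr_add[of s \<nu> "- \<kappa>"] by simp
    also have "\<dots> \<le> (2 * real n powr ((- r + \<kappa>) * \<nu>)) * real n powr ((- r - \<kappa>) * (- \<kappa>))"
      by (intro mult_mono s1 s2) auto
    also have "\<dots> = 2 * real n powr ((- r + \<kappa>) * \<nu> + (- r - \<kappa>) * (- \<kappa>))"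
      unfolding powr_add by (simp only: mult.assoc)
    also have "\<dots> \<le> 2 * real n powr d" using expo2 n by (intro mult_left_mono powr_mono) auto
    finally have "\<delta> s \<le> C * (2 * real n powr d)"
      using s(4) C(1) by (meson mult_left_mono less_imp_le order_trans)
    moreover have "0 < \<delta> s" by (rule Q_classD(1)[OF Q s0])
    ultimately have "b n * \<delta> s \<le> (K * sqrt (ln (real n) / real n)) * (C * (2 * real n powr d))"
      using elim(2) elim(7) by (intro mult_mono) auto
    also have "\<dots> = (K * C * 2) * sqrt (ln (real n) / real n) * real n powr d" by simp
    also have "\<dots> \<le> (\<epsilon> * c) * real n powr ((1/2 - \<gamma>) - 1/2)" by (rule elim(5))
    also have "\<dots> = \<epsilon> * (c * real n powr - \<gamma>)" by simp
    also have "\<dots> \<le> \<epsilon> * lam n" using elim(3) e by (intro mult_left_mono) auto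
    finally have bs: "b n * \<delta> s \<le> \<epsilon> * lam n" .
    have "real n * s \<le> real n * ((x * c\<^sup>2) * real n powr (- 2 * \<gamma> + 1))"
      using sb(2) elim(6) n by (intro mult_left_mono) auto
    also have "\<dots> = x * (c * real n powr - \<gamma> * real n)\<^sup>2"
    proof -
      have "real n powr (- 2 * \<gamma> + 1) = (real n powr - \<gamma>)\<^sup>2 * real n"
        using powr_add[of "real n" "- \<gamma> + - \<gamma>" 1] powr_add[of "real n" "- \<gamma>" "- \<gamma>"] n
        by (simp add: power2_eq_square)
      then show ?thesis by (simp add: power2_eq_square)
    qed
    also have "\<dots> \<le> x * (lam n * real n)\<^sup>2"
      using elim(3) c x n by (intro mult_left_mono power_mono mult_right_mono) auto
    finally have "real n * s \<le> x * (lam n * real n)\<^sup>2" .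
    moreover have "s \<le> \<epsilon>" using sb small by linarith
    ultimately show ?case using s0 qs bs by blast
  qed
qed

text \<open>At the good point four losses of at most \<open>\<epsilon> * lam n\<close> occur: null
  fluctuation, uncounted false nulls, the centring term \<open>lam n * s\<close>, and the
  penalty.\<close>

lemma lhat_falls_short_tendsto:
  assumes gap: "\<nu> * r > \<gamma> - 1/2" and e: "0 < \<epsilon>" "\<epsilon> < 1/4"
  shows "(\<lambda>n. measure (M n) {\<omega>\<in>space (M n). lhat n \<omega> < ereal ((1 - 4 * \<epsilon>) * lam n)}) \<longlonglongrightarrow> 0"
proof (rule tendsto_0_if_eventually_less)
  fix x :: real assume x: "x > 0"
  \<comment> \<open>The budget is \<open>x / 4\<close> for the uncounted false nulls by Markov and
    \<open>x / 2\<close> for the null fluctuation by Chebyshev, below \<open>x\<close> in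
    total.\<close>
  define q where "q = max (1/2) (1 - \<epsilon> * x / 4)"
  have q: "0 < q" "q < 1" "(1 - q) / \<epsilon> \<le> x / 4" using e x by (auto simp: q_def max_def field_simps)
  have x': "0 < \<epsilon>\<^sup>2 * x / 2" using e x by simp
  from eventually_good_point[OF gap q(1,2) e(1) x'] eventually_lam eventually_ge_at_top[of 1]
  show "\<forall>\<^sub>F n in sequentially. measure (M n) {\<omega>\<in>space (M n). lhat n \<omega> < ereal ((1 - 4 * \<epsilon>) * lam n)} < x"
  proof eventually_elim
    case (elim n)
    interpret prob_space "M n" by (rule prob_M)
    interpret Gn: real_distribution "G n" by (rule G_distribution)
    obtain s where s: "0 < s" "s < 1" "q \<le> cdf (G n) s" "s \<le> \<epsilon>" "b n * \<delta> s \<le> \<epsilon> * lam n"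
      "real n * s \<le> \<epsilon>\<^sup>2 * x / 2 * (lam n * real n)\<^sup>2"
      using elim(1) by auto
    define m where "m = lam n * real n"
    have m: "0 < m" using elim by (simp add: m_def)
    define B where "B = {\<omega>\<in>space (M n). \<epsilon> * (lam n * real n) \<le> real (card {i\<in>A n. P n i \<omega> \<in> {s<..}})}"
    define D where "D = {\<omega>\<in>space (M n). cnt n (nulls n) s \<omega> \<le> real (card (nulls n)) * s - \<epsilon> * m}"
    have B: "B \<in> events" unfolding B_def by (rule sets_A_count) simp
    have "measure (G n) {s<..} = 1 - cdf (G n) s"
      using Gn.prob_compl[of "{..s}"] by (simp add: cdf_def Compl_eq_Diff_UNIV[symmetric])
    then have "measure (G n) {s<..} \<le> 1 - q" using s by simp
    then have pB: "prob B \<le> (1 - q) / \<epsilon>"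
      unfolding B_def by (intro A_count_ge) (use elim(2,3) e in simp_all)
    have D: "D \<in> events" unfolding D_def by (rule sets_nulls_count)
    have "prob D \<le> real (card (nulls n)) * s / (\<epsilon> * m)\<^sup>2"
      unfolding D_def using s e m by (intro nulls_count_le) auto
    also have "\<dots> \<le> (real n * s) / (\<epsilon> * m)\<^sup>2"
      using elim s by (intro divide_right_mono mult_right_mono) (auto simp: card_nulls)
    also have "\<dots> \<le> (\<epsilon>\<^sup>2 * x / 2 * m\<^sup>2) / (\<epsilon> * m)\<^sup>2"
      using s(6) unfolding m_def by (intro divide_right_mono) auto
    also have "\<dots> = x / 2" using e m by (simp add: power_mult_distrib)
    finally have pD: "prob D \<le> x / 2" .
    have "{\<omega>\<in>space (M n). lhat n \<omega> < ereal ((1 - 4 * \<epsilon>) * lam n)} \<subseteq> D \<union> B"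
    proof (rule subsetI, rule ccontr)
      fix \<omega> assume "\<omega> \<in> {\<omega>\<in>space (M n). lhat n \<omega> < ereal ((1 - 4 * \<epsilon>) * lam n)}" "\<omega> \<notin> D \<union> B"
      then have \<omega>: "\<omega> \<in> space (M n)" and lt: "lhat n \<omega> < ereal ((1 - 4 * \<epsilon>) * lam n)"
        and N: "real (card (nulls n)) * s - \<epsilon> * m < cnt n (nulls n) s \<omega>"
        and J: "real (card {i\<in>A n. P n i \<omega> \<in> {s<..}}) < \<epsilon> * m"
        by (auto simp: B_def D_def m_def)
      have J': "m - \<epsilon> * m < cnt n (A n) s \<omega>"
        using J card_le_add_card_gt[OF finite_A[of n], of "\<lambda>i. P n i \<omega>" s] card_A[of n] by (simp add: m_def)
      let ?F = "ecdf n (\<lambda>i. P n i \<omega>) s"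
      have "m * s \<le> m * \<epsilon>" using s m by (intro mult_left_mono) auto
      then have "m * (1 - 3 * \<epsilon>) \<le> cnt n (nulls n) s \<omega> + cnt n (A n) s \<omega> - real n * s"
        using N J' by (simp add: card_nulls m_def algebra_simps)
      also have "\<dots> = real n * (?F - s)" using elim by (simp add: ecdf_eq field_simps)
      finally have "real n * (lam n * (1 - 3 * \<epsilon>)) \<le> real n * (?F - s)" by (simp add: m_def mult_ac)
      then have "lam n * (1 - 3 * \<epsilon>) \<le> ?F - s" using elim by simp
      then have *: "(1 - 4 * \<epsilon>) * lam n \<le> ?F - s - b n * \<delta> s" using s(5) by (simp add: algebra_simps)
      \<comment> \<open>Dividing by \<open>1 - s\<close> preserves the bound because it is
        nonnegative, which is where \<open>\<epsilon> < 1/4\<close> enters.\<close>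
      have "0 \<le> (1 - 4 * \<epsilon>) * lam n" using e elim by simp
      then have "(1 - 4 * \<epsilon>) * lam n * (1 - s) \<le> (1 - 4 * \<epsilon>) * lam n"
        using s by (intro mult_left_le) auto
      with * have "(1 - 4 * \<epsilon>) * lam n \<le> (?F - s - b n * \<delta> s) / (1 - s)"
        using s by (simp add: pos_le_divide_eq)
      then have "ereal ((1 - 4 * \<epsilon>) * lam n) \<le> ereal ((?F - s - b n * \<delta> s) / (1 - s))" by simp
      also have "\<dots> \<le> lhat n \<omega>" by (rule lhat_ge[OF s(1,2)])
      finally show False using lt by simp
    qed
    then have "prob {\<omega>\<in>space (M n). lhat n \<omega> < ereal ((1 - 4 * \<epsilon>) * lam n)} \<le> prob (D \<union> B)"
      using B D by (intro finite_measure_mono) auto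
    also have "\<dots> \<le> prob D + prob B" using B D by (intro measure_Un_le) auto
    also have "\<dots> < x" using pB pD q(3) x by linarith
    finally show ?case .
  qed
qed auto

text \<open>A sure statement: evaluated near 0 where \<open>\<delta>\<close> is small, the numerator
  is at least a quantity arbitrarily close to 0.\<close>

lemma lhat_nonneg:
  assumes "Liminf (at_right 0) (\<lambda>t. ereal (\<delta> t)) = 0" and b: "0 < b n"
  shows "0 \<le> lhat n \<omega>"
proof (rule ccontr)
  assume "\<not> 0 \<le> lhat n \<omega>"
  then obtain y where "ereal y < 0" and y: "lhat n \<omega> < ereal y"
    using ereal_dense2[of "lhat n \<omega>" 0] by (auto simp: not_le)
  then have y0: "y < 0" by simp
  \<comment> \<open>With \<open>t\<close> and \<open>b n * \<delta> t\<close> at most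
    \<open>z\<close> the numerator is at least \<open>y / 2\<close>, and
    \<open>1 - t \<ge> 1/2\<close> makes up for the remaining factor 2.\<close>
  define z where "z = min (1/2) (- y / 4)"
  have z: "0 < z" "z \<le> 1/2" "4 * z \<le> - y" using y0 by (auto simp: z_def)
  have "\<exists>t. 0 < t \<and> t < z \<and> \<delta> t \<le> z / b n"
  proof (rule ccontr)
    assume neg: "\<not> ?thesis"
    have "ereal (z / b n) \<le> Liminf (at_right 0) (\<lambda>t. ereal (\<delta> t))"
      using neg z by (intro Liminf_bounded eventually_at_rightI[of 0 z]) (auto simp: not_le intro: less_imp_le)
    moreover have "0 < z / b n" using b z by simp
    ultimately show False using assms(1) by simp
  qed
  then obtain t where t: "0 < t" "t < z" "\<delta> t \<le> z / b n" by auto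
  have "b n * \<delta> t \<le> z" using t(3) b by (simp add: field_simps)
  moreover have "0 \<le> ecdf n (\<lambda>i. P n i \<omega>) t" by (simp add: ecdf_def)
  ultimately have "y / 2 \<le> ecdf n (\<lambda>i. P n i \<omega>) t - t - b n * \<delta> t" using t z by linarith
  moreover have "y * (1 - t) \<le> y / 2"
    using mult_left_mono_neg[of "1/2" "1 - t" y] t z y0 by simp
  ultimately have "y * (1 - t) \<le> ecdf n (\<lambda>i. P n i \<omega>) t - t - b n * \<delta> t"
    by linarith
  then have "y \<le> (ecdf n (\<lambda>i. P n i \<omega>) t - t - b n * \<delta> t) / (1 - t)"
    using t z by (simp add: pos_le_divide_eq)
  then have "ereal y \<le> ereal ((ecdf n (\<lambda>i. P n i \<omega>) t - t - b n * \<delta> t) / (1 - t))" by simp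
  also have "\<dots> \<le> lhat n \<omega>" using t z by (intro lhat_ge) auto
  finally show False using y by simp
qed

section \<open>From tail bounds to convergence in probability\<close>

text \<open>Multiplying out \<open>lam n\<close>, which is eventually positive, splits a deviation
  of the ratio into an upper and a lower tail; infinite values fall into one of them.\<close>

lemma ratio_tendsto_in_prob:
  fixes Y :: "nat \<Rightarrow> 'a \<Rightarrow> ereal"
  assumes Y: "\<And>n. Y n \<in> borel_measurable (M n)"
    and up: "\<And>\<epsilon>. \<epsilon> > 0 \<Longrightarrow> (\<lambda>n. measure (M n) {\<omega>\<in>space (M n). ereal ((c + \<epsilon>) * lam n) < Y n \<omega>}) \<longlonglongrightarrow> 0"
    and lo: "\<And>\<epsilon>. \<epsilon> > 0 \<Longrightarrow> (\<lambda>n. measure (M n) {\<omega>\<in>space (M n). Y n \<omega> < ereal ((c - \<epsilon>) * lam n)}) \<longlonglongrightarrow> 0"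
  shows "tendsto_in_prob M (\<lambda>n \<omega>. Y n \<omega> / ereal (lam n)) (ereal c)"
  unfolding tendsto_in_prob_def
proof (intro conjI allI impI)
  show "(\<lambda>\<omega>. Y n \<omega> / ereal (lam n)) \<in> borel_measurable (M n)" for n
    using Y[of n] by measurable
  fix \<epsilon> :: real assume e: "\<epsilon> > 0"
  let ?U = "\<lambda>n. {\<omega>\<in>space (M n). ereal ((c + \<epsilon>) * lam n) < Y n \<omega>}"
  let ?L = "\<lambda>n. {\<omega>\<in>space (M n). Y n \<omega> < ereal ((c - \<epsilon>) * lam n)}"
  have lim: "(\<lambda>n. measure (M n) (?U n) + measure (M n) (?L n)) \<longlonglongrightarrow> 0"
    using tendsto_add[OF up[OF e] lo[OF e]] by simp
  have "\<forall>\<^sub>F n in sequentially. measure (M n) {\<omega>\<in>space (M n). \<bar>Y n \<omega> / ereal (lam n) - ereal c\<bar> > ereal \<epsilon>}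
      \<le> measure (M n) (?U n) + measure (M n) (?L n)"
    using eventually_lam
  proof eventually_elim
    case (elim n)
    interpret prob_space "M n" by (rule prob_M)
    have sets: "?U n \<in> events" "?L n \<in> events" using Y[of n] by measurable
    have sub: "{\<omega>\<in>space (M n). \<bar>Y n \<omega> / ereal (lam n) - ereal c\<bar> > ereal \<epsilon>} \<subseteq> ?U n \<union> ?L n"
    proof
      fix \<omega> assume \<omega>: "\<omega> \<in> {\<omega>\<in>space (M n). \<bar>Y n \<omega> / ereal (lam n) - ereal c\<bar> > ereal \<epsilon>}"
      show "\<omega> \<in> ?U n \<union> ?L n"
      proof (cases "Y n \<omega>")
        case (real y)
        then have "\<epsilon> < \<bar>y / lam n - c\<bar>" using \<omega> elim by simp
        then have "c + \<epsilon> < y / lam n \<or> y / lam n < c - \<epsilon>" by linarith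
        then show ?thesis using \<omega> elim real by (auto simp: pos_less_divide_eq pos_divide_less_eq)
      qed (use \<omega> in auto)
    qed
    have "prob {\<omega>\<in>space (M n). \<bar>Y n \<omega> / ereal (lam n) - ereal c\<bar> > ereal \<epsilon>} \<le> prob (?U n \<union> ?L n)"
      using sub sets by (intro finite_measure_mono) auto
    also have "\<dots> \<le> prob (?U n) + prob (?L n)" using sets by (intro measure_Un_le) auto
    finally show ?case .
  qed
  then show "(\<lambda>n. measure (M n) {\<omega>\<in>space (M n). \<bar>Y n \<omega> / ereal (lam n) - ereal c\<bar> > ereal \<epsilon>}) \<longlonglongrightarrow> 0"
    by (intro tendsto_sandwich[OF _ _ tendsto_const lim]) auto
qed

lemma tail_mono_tendsto:
  assumes lim: "(\<lambda>n. measure (M n) (E n)) \<longlonglongrightarrow> 0" and E: "\<And>n. E n \<in> sets (M n)"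
    and sub: "\<forall>\<^sub>F n in sequentially. F n \<subseteq> E n"
  shows "(\<lambda>n. measure (M n) (F n)) \<longlonglongrightarrow> 0"
proof (rule tendsto_sandwich[OF _ _ tendsto_const lim])
  show "\<forall>\<^sub>F n in sequentially. measure (M n) (F n) \<le> measure (M n) (E n)"
    using sub
  proof eventually_elim
    case (elim n)
    interpret prob_space "M n" by (rule prob_M)
    show ?case using elim E by (rule finite_measure_mono)
  qed
qed auto

lemma above_boundary:
  assumes gap: "\<nu> * r > \<gamma> - 1/2"
  shows "tendsto_in_prob M (\<lambda>n \<omega>. lhat n \<omega> / ereal (lam n)) 1"
  unfolding one_ereal_def
proof (rule ratio_tendsto_in_prob[OF lhat_measurable])
  fix \<epsilon> :: real assume e: "\<epsilon> > 0"
  then show "(\<lambda>n. measure (M n) {\<omega>\<in>space (M n). ereal ((1 + \<epsilon>) * lam n) < lhat n \<omega>}) \<longlonglongrightarrow> 0"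
    by (rule lhat_exceeds_tendsto)
  define \<epsilon>' where "\<epsilon>' = min (1/8) (\<epsilon> / 4)"
  have e': "0 < \<epsilon>'" "\<epsilon>' < 1/4" "4 * \<epsilon>' \<le> \<epsilon>" using e by (auto simp: \<epsilon>'_def)
  show "(\<lambda>n. measure (M n) {\<omega>\<in>space (M n). lhat n \<omega> < ereal ((1 - \<epsilon>) * lam n)}) \<longlonglongrightarrow> 0"
  proof (rule tail_mono_tendsto[OF lhat_falls_short_tendsto[OF gap e'(1,2)]])
    show "{\<omega> \<in> space (M n). lhat n \<omega> < ereal ((1 - 4 * \<epsilon>') * lam n)} \<in> sets (M n)" for n by measurable
    show "\<forall>\<^sub>F n in sequentially. {\<omega>\<in>space (M n). lhat n \<omega> < ereal ((1 - \<epsilon>) * lam n)}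
        \<subseteq> {\<omega> \<in> space (M n). lhat n \<omega> < ereal ((1 - 4 * \<epsilon>') * lam n)}"
      using eventually_lam
    proof eventually_elim
      case (elim n)
      then have "ereal ((1 - \<epsilon>) * lam n) \<le> ereal ((1 - 4 * \<epsilon>') * lam n)"
        using e' by (simp add: mult_right_mono)
      then show ?case by (auto intro: less_le_trans)
    qed
  qed
qed

lemma below_boundary_upper:
  assumes gap: "\<nu> * r < \<gamma> - 1/2" and e: "\<epsilon> > 0"
  shows "(\<lambda>n. measure (M n) {\<omega>\<in>space (M n). ereal ((0 + \<epsilon>) * lam n) < lhat n \<omega>}) \<longlonglongrightarrow> 0"
proof -
  define \<epsilon>' where "\<epsilon>' = min 1 (\<epsilon> / 2)"
  have e': "0 < \<epsilon>'" "\<epsilon>' \<le> 1" "2 * \<epsilon>' \<le> \<epsilon>" using e by (auto simp: \<epsilon>'_def)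
  show ?thesis
  proof (rule tail_mono_tendsto[OF lhat_exceeds_small_tendsto[OF gap e'(1,2)]])
    show "{\<omega> \<in> space (M n). ereal (2 * \<epsilon>' * lam n) < lhat n \<omega>} \<in> sets (M n)" for n by measurable
    show "\<forall>\<^sub>F n in sequentially. {\<omega>\<in>space (M n). ereal ((0 + \<epsilon>) * lam n) < lhat n \<omega>}
        \<subseteq> {\<omega> \<in> space (M n). ereal (2 * \<epsilon>' * lam n) < lhat n \<omega>}"
      using eventually_lam
    proof eventually_elim
      case (elim n)
      then have "ereal (2 * \<epsilon>' * lam n) \<le> ereal ((0 + \<epsilon>) * lam n)"
        using e' by (simp add: mult_right_mono)
      from le_less_trans[OF this] show ?case by blast
    qed
  qed
qed

text \<open>The lower tail is eventually empty since the estimator is nonnegative, which rests on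
  \<open>\<delta>\<close> coming close to 0 at 0; for \<open>\<nu> > 0\<close> this is
  automatic.\<close>

lemma below_boundary:
  assumes gap: "\<nu> * r < \<gamma> - 1/2" and "\<nu> > 0 \<or> Liminf (at_right 0) (\<lambda>t. ereal (\<delta> t)) = 0"
  shows "tendsto_in_prob M (\<lambda>n \<omega>. lhat n \<omega> / ereal (lam n)) 0"
  unfolding zero_ereal_def
proof (rule ratio_tendsto_in_prob[OF lhat_measurable below_boundary_upper[OF gap]])
  fix \<epsilon> :: real assume e: "\<epsilon> > 0"
  have L: "Liminf (at_right 0) (\<lambda>t. ereal (\<delta> t)) = 0" using assms(2) Q_class_Liminf_zero[OF Q] by auto
  show "(\<lambda>n. measure (M n) {\<omega>\<in>space (M n). lhat n \<omega> < ereal ((0 - \<epsilon>) * lam n)}) \<longlonglongrightarrow> 0"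
  proof (rule tail_mono_tendsto[where E = "\<lambda>_. {}"])
    show "\<forall>\<^sub>F n in sequentially. {\<omega>\<in>space (M n). lhat n \<omega> < ereal ((0 - \<epsilon>) * lam n)} \<subseteq> {}"
      using eventually_lam eventually_b_pos
    proof eventually_elim
      case (elim n)
      have "ereal ((0 - \<epsilon>) * lam n) \<le> lhat n \<omega>" for \<omega>
      proof (rule order_trans)
        show "ereal ((0 - \<epsilon>) * lam n) \<le> 0" using elim e by simp
        show "0 \<le> lhat n \<omega>" using elim by (intro lhat_nonneg L)
      qed
      then show ?case by (auto simp flip: not_le)
    qed
  qed auto
qed

text \<open>Above a positive level the positive part has the same tail as the estimator, and its
  lower tail is empty however \<open>\<delta>\<close> behaves at 0.\<close>

lemma below_boundary_pos_part:
  assumes gap: "\<nu> * r < \<gamma> - 1/2"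
  shows "tendsto_in_prob M (\<lambda>n \<omega>. max 0 (lhat n \<omega>) / ereal (lam n)) 0"
  unfolding zero_ereal_def
proof (rule ratio_tendsto_in_prob)
  show "(\<lambda>\<omega>. max (ereal 0) (lhat n \<omega>)) \<in> borel_measurable (M n)" for n by measurable
  fix \<epsilon> :: real assume e: "\<epsilon> > 0"
  show "(\<lambda>n. measure (M n) {\<omega>\<in>space (M n). ereal ((0 + \<epsilon>) * lam n) < max (ereal 0) (lhat n \<omega>)}) \<longlonglongrightarrow> 0"
  proof (rule tail_mono_tendsto[OF below_boundary_upper[OF gap e]])
    show "{\<omega>\<in>space (M n). ereal ((0 + \<epsilon>) * lam n) < lhat n \<omega>} \<in> sets (M n)" for n by measurable
    show "\<forall>\<^sub>F n in sequentially. {\<omega>\<in>space (M n). ereal ((0 + \<epsilon>) * lam n) < max (ereal 0) (lhat n \<omega>)}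
        \<subseteq> {\<omega>\<in>space (M n). ereal ((0 + \<epsilon>) * lam n) < lhat n \<omega>}"
      using eventually_lam
    proof eventually_elim
      case (elim n)
      have "\<not> ereal ((0 + \<epsilon>) * lam n) < ereal 0" using elim e by (simp add: not_less)
      then show ?case by (auto simp: max_def split: if_splits)
    qed
  qed
  show "(\<lambda>n. measure (M n) {\<omega>\<in>space (M n). max (ereal 0) (lhat n \<omega>) < ereal ((0 - \<epsilon>) * lam n)}) \<longlonglongrightarrow> 0"
  proof (rule tail_mono_tendsto[where E = "\<lambda>_. {}"])
    show "\<forall>\<^sub>F n in sequentially. {\<omega>\<in>space (M n). max (ereal 0) (lhat n \<omega>) < ereal ((0 - \<epsilon>) * lam n)} \<subseteq> {}"
      using eventually_lam
    proof eventually_elim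
      case (elim n)
      have "\<not> ereal 0 < ereal ((0 - \<epsilon>) * lam n)" using elim e by (simp add: not_less)
      then show ?case by auto
    qed
  qed auto
qed

end

(* The hypotheses r > (gamma - 1/2) / nu and r < (gamma - 1/2) / nu are multiplied out by nu,
   which is also how they are read for nu = 0.
   If delta stays bounded away from 0 near 0 (possible only for nu = 0, e.g. delta constant),
   then below the boundary the supremum is negative of the order of beta, which dominates
   lambda, so only its positive part is negligible relative to lambda.  Hence the last two
   conclusions; they coincide when nu > 0. *)
theorem theorem3:
  fixes M :: "nat \<Rightarrow> 'a measure"
    and P :: "nat \<Rightarrow> nat \<Rightarrow> 'a \<Rightarrow> real"
    and A :: "nat \<Rightarrow> nat set"
    and G :: "nat \<Rightarrow> real measure"
    and lam \<alpha> :: "nat \<Rightarrow> real"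
    and \<beta> :: "real \<Rightarrow> nat \<Rightarrow> real"
    and \<delta> :: "real \<Rightarrow> real"
    and \<gamma> r \<nu> :: real
  assumes "\<And>n. prob_space (M n)"
    and "\<And>n. prob_space.indep_vars (M n) (\<lambda>_. borel) (P n) {..<n}"
    and "\<And>n. A n \<subseteq> {..<n}"
    and "\<And>n. real (card (A n)) = lam n * real n"
    and "\<And>n i. i \<in> {..<n} - A n \<Longrightarrow> distr (M n) borel (P n i) = unif01"
    and "\<And>n i. i \<in> A n \<Longrightarrow> distr (M n) borel (P n i) = G n"
    and "\<And>n. real_distribution (G n)"
    and "\<And>n. measure (G n) {0..1} = 1"
    and "\<gamma> \<in> {1/2..<1}"
    and "\<exists>c>0. (\<lambda>n. real n powr \<gamma> * lam n) \<longlonglongrightarrow> c"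
    and "r \<in> {0<..<1}"
    and "\<And>q. q \<in> {0<..<1} \<Longrightarrow>
           (\<lambda>n. ln (quantile (G n) q) / (- r * ln (real n))) \<longlonglongrightarrow> 1"
    and "\<nu> \<in> {0..1/2}"
    and "\<delta> \<in> Q_class \<nu>"
    and "\<And>n. n \<ge> 1 \<Longrightarrow> bounding_seq \<delta> (\<alpha> n) (\<beta> (\<alpha> n))"
    and "vanishes_slowly \<delta> \<beta> \<alpha>"
  shows "(\<nu> * r > \<gamma> - 1/2 \<longrightarrow>
           tendsto_in_prob M
             (\<lambda>n \<omega>. lambda_hat n \<delta> (\<beta> (\<alpha> n) n) (\<lambda>i. P n i \<omega>) / ereal (lam n)) 1)
       \<and> (\<nu> * r < \<gamma> - 1/2 \<and> (\<nu> > 0 \<or> Liminf (at_right 0) (\<lambda>t. ereal (\<delta> t)) = 0) \<longrightarrow>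
           tendsto_in_prob M
             (\<lambda>n \<omega>. lambda_hat n \<delta> (\<beta> (\<alpha> n) n) (\<lambda>i. P n i \<omega>) / ereal (lam n)) 0)
       \<and> (\<nu> * r < \<gamma> - 1/2 \<longrightarrow>
           tendsto_in_prob M
             (\<lambda>n \<omega>. max 0 (lambda_hat n \<delta> (\<beta> (\<alpha> n) n) (\<lambda>i. P n i \<omega>)) / ereal (lam n)) 0)"
proof -
  interpret sparse_mixture M P A G lam \<alpha> \<beta> \<delta> \<gamma> r \<nu>
    by (rule sparse_mixture.intro) (fact assms)+
  show ?thesis
    using above_boundary below_boundary below_boundary_pos_part by (simp add: lhat_def)
qed

end
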